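(* Let $k$ be a field and let $R$ be a $k$-algebra. Let $I$ and $J_1\subsetneq J_2$ be (two-sided) ideals of $R$ such that $J_2/J_1$ is free of rank $s$ as a left $R/I$-module and free of rank $t$ as a right $R/I$-module, where $s,t$ are integers. If $s<t$, then there is no finite $\mathbb{N}$-filtration $\Gamma$ of $R$ such that the associated graded ring $\operatorname{gr}_\Gamma R$ is left noetherian.
   Context: All algebras are associative, unital, over a fixed field $k$. Saying that $J_2/J_1$ is a left and a right $R/I$-module (with the structures induced from the $R$-bimodule structure) includes $IJ_2\subseteq J_1$ and $J_2I\subseteq J_1$. An $\mathbb{N}$-filtration $\Gamma=\{\Gamma_i : i\in\mathbb{N}\}$ of $R$ (with $0\in\mathbb N$) is an ascending chain of $k$-subspaces of $R$ with $1\in\Gamma_0$, $\bigcup_{j}\Gamma_j=R$ and $\Gamma_i\Gamma_j\subseteq\Gamma_{i+j}$ for all $i,j$. It is finite if $\dim_k\Gamma_i<\infty$ for all $i$. The associated graded ring is $\operatorname{gr}_\Gamma R=\bigoplus_{i\ge 0}\Gamma_i/\Gamma_{i-1}$, with $\Gamma_{-1}=0$. *)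

theory Defs
  imports "HOL-Algebra.QuotRing" "HOL-Algebra.Module" "HOL-Algebra.Subrings" "HOL-Algebra.UnivPoly"
begin

locale assoc_algebra = ring R + K: field K + module K R
  for K :: "('k, 'c) ring_scheme" (structure) and R :: "('k, 'a, 'b) module_scheme" (structure) +
  assumes smult_mult_left:
      "\<lbrakk>a \<in> carrier K; x \<in> carrier R; y \<in> carrier R\<rbrakk> \<Longrightarrow>
       (a \<odot>\<^bsub>R\<^esub> x) \<otimes>\<^bsub>R\<^esub> y = a \<odot>\<^bsub>R\<^esub> (x \<otimes>\<^bsub>R\<^esub> y)"
    and smult_mult_right:
      "\<lbrakk>a \<in> carrier K; x \<in> carrier R; y \<in> carrier R\<rbrakk> \<Longrightarrow>
       x \<otimes>\<^bsub>R\<^esub> (a \<odot>\<^bsub>R\<^esub> y) = a \<odot>\<^bsub>R\<^esub> (x \<otimes>\<^bsub>R\<^esub> y)"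

text \<open>
  The library's locale \<^locale>\<open>module\<close> requires a commutative ring of scalars. The following
  one-sided modules over arbitrary rings have the action as an explicit parameter; the
  multiplicative fields of the record \<open>M\<close> play no role.
\<close>

locale left_module = A?: ring A + M?: abelian_group M
  for A :: "('a, 'c) ring_scheme" (structure) and M :: "('m, 'd) ring_scheme" (structure) +
  fixes lact :: "'a \<Rightarrow> 'm \<Rightarrow> 'm"
  assumes lact_closed:
      "\<lbrakk>a \<in> carrier A; x \<in> carrier M\<rbrakk> \<Longrightarrow> lact a x \<in> carrier M"
    and lact_l_distr:
      "\<lbrakk>a \<in> carrier A; b \<in> carrier A; x \<in> carrier M\<rbrakk> \<Longrightarrow>
       lact (a \<oplus>\<^bsub>A\<^esub> b) x = lact a x \<oplus>\<^bsub>M\<^esub> lact b x"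
    and lact_r_distr:
      "\<lbrakk>a \<in> carrier A; x \<in> carrier M; y \<in> carrier M\<rbrakk> \<Longrightarrow>
       lact a (x \<oplus>\<^bsub>M\<^esub> y) = lact a x \<oplus>\<^bsub>M\<^esub> lact a y"
    and lact_assoc:
      "\<lbrakk>a \<in> carrier A; b \<in> carrier A; x \<in> carrier M\<rbrakk> \<Longrightarrow>
       lact (a \<otimes>\<^bsub>A\<^esub> b) x = lact a (lact b x)"
    and lact_one:
      "x \<in> carrier M \<Longrightarrow> lact \<one>\<^bsub>A\<^esub> x = x"

locale right_module = A?: ring A + M?: abelian_group M
  for A :: "('a, 'c) ring_scheme" (structure) and M :: "('m, 'd) ring_scheme" (structure) +
  fixes ract :: "'m \<Rightarrow> 'a \<Rightarrow> 'm"
  assumes ract_closed: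
      "\<lbrakk>x \<in> carrier M; a \<in> carrier A\<rbrakk> \<Longrightarrow> ract x a \<in> carrier M"
    and ract_r_distr:
      "\<lbrakk>x \<in> carrier M; a \<in> carrier A; b \<in> carrier A\<rbrakk> \<Longrightarrow>
       ract x (a \<oplus>\<^bsub>A\<^esub> b) = ract x a \<oplus>\<^bsub>M\<^esub> ract x b"
    and ract_l_distr:
      "\<lbrakk>x \<in> carrier M; y \<in> carrier M; a \<in> carrier A\<rbrakk> \<Longrightarrow>
       ract (x \<oplus>\<^bsub>M\<^esub> y) a = ract x a \<oplus>\<^bsub>M\<^esub> ract y a"
    and ract_assoc:
      "\<lbrakk>x \<in> carrier M; a \<in> carrier A; b \<in> carrier A\<rbrakk> \<Longrightarrow>
       ract x (a \<otimes>\<^bsub>A\<^esub> b) = ract (ract x a) b"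
    and ract_one:
      "x \<in> carrier M \<Longrightarrow> ract x \<one>\<^bsub>A\<^esub> = x"

text \<open>
  Free of rank \<open>n\<close>: there is a basis indexed by \<open>{..<n}\<close>. Without the invariant basis
  property a module may be free of several ranks.
\<close>

definition left_free_of_rank ::
    "('a, 'c) ring_scheme \<Rightarrow> ('m, 'd) ring_scheme \<Rightarrow> ('a \<Rightarrow> 'm \<Rightarrow> 'm) \<Rightarrow> nat \<Rightarrow> bool"
  where "left_free_of_rank A M lact n \<longleftrightarrow> left_module A M lact \<and>
    (\<exists>e \<in> {..<n} \<rightarrow> carrier M. \<forall>x \<in> carrier M.
       \<exists>!c. c \<in> {..<n} \<rightarrow>\<^sub>E carrier A \<and> x = (\<Oplus>\<^bsub>M\<^esub>i\<in>{..<n}. lact (c i) (e i)))"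

definition right_free_of_rank ::
    "('a, 'c) ring_scheme \<Rightarrow> ('m, 'd) ring_scheme \<Rightarrow> ('m \<Rightarrow> 'a \<Rightarrow> 'm) \<Rightarrow> nat \<Rightarrow> bool"
  where "right_free_of_rank A M ract n \<longleftrightarrow> right_module A M ract \<and>
    (\<exists>e \<in> {..<n} \<rightarrow> carrier M. \<forall>x \<in> carrier M.
       \<exists>!c. c \<in> {..<n} \<rightarrow>\<^sub>E carrier A \<and> x = (\<Oplus>\<^bsub>M\<^esub>i\<in>{..<n}. ract (e i) (c i)))"

text \<open>
  The additive group \<open>V/U\<close> for additive subgroups \<open>U \<subseteq> V\<close> of \<open>R\<close>, as a subgroup of \<open>R/U\<close>.
  Only the additive fields of the record are meaningful in general.
\<close>

definition subquotient :: "('a, 'b) ring_scheme \<Rightarrow> 'a set \<Rightarrow> 'a set \<Rightarrow> 'a set ring"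
  where "subquotient R V U = (R Quot U)\<lparr>carrier := (\<lambda>x. U +>\<^bsub>R\<^esub> x) ` V\<rparr>"

text \<open>
  For ideals with \<open>I J\<^sub>2 \<subseteq> J\<^sub>1\<close> and \<open>J\<^sub>2 I \<subseteq> J\<^sub>1\<close>, the actions of \<open>R/I\<close> on \<open>J\<^sub>2/J\<^sub>1\<close>
  induced from the bimodule structure, \<open>(I + r)(J\<^sub>1 + x) = J\<^sub>1 + rx\<close> and
  \<open>(J\<^sub>1 + x)(I + r) = J\<^sub>1 + xr\<close>, are both given by \<^term>\<open>rcoset_mult R J1\<close>,
  the union of the cosets \<open>J\<^sub>1 + ab\<close> over all representatives \<open>a\<close>, \<open>b\<close> of the factors.
\<close>

lemma rcoset_mult_well_defined:
  assumes "ring R" "additive_subgroup U R" "additive_subgroup V R" "additive_subgroup W R"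
    and x: "x \<in> carrier R" and y: "y \<in> carrier R"
    and 1: "\<And>u. u \<in> U \<Longrightarrow> u \<otimes>\<^bsub>R\<^esub> y \<in> W" and 2: "\<And>v. v \<in> V \<Longrightarrow> x \<otimes>\<^bsub>R\<^esub> v \<in> W"
    and 3: "\<And>u v. \<lbrakk>u \<in> U; v \<in> V\<rbrakk> \<Longrightarrow> u \<otimes>\<^bsub>R\<^esub> v \<in> W"
  shows "rcoset_mult R W (U +>\<^bsub>R\<^esub> x) (V +>\<^bsub>R\<^esub> y) = W +>\<^bsub>R\<^esub> (x \<otimes>\<^bsub>R\<^esub> y)"
proof -
  interpret ring R by fact
  interpret U: additive_subgroup U R by fact
  interpret V: additive_subgroup V R by fact
  interpret W: additive_subgroup W R by fact
  have *: "W +>\<^bsub>R\<^esub> ((u \<oplus>\<^bsub>R\<^esub> x) \<otimes>\<^bsub>R\<^esub> (v \<oplus>\<^bsub>R\<^esub> y)) = W +>\<^bsub>R\<^esub> (x \<otimes>\<^bsub>R\<^esub> y)"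
    if uv: "u \<in> U" "v \<in> V" for u v
  proof -
    have c: "u \<in> carrier R" "v \<in> carrier R"
      using uv U.a_Hcarr V.a_Hcarr by blast+
    define w where "w = u \<otimes>\<^bsub>R\<^esub> v \<oplus>\<^bsub>R\<^esub> u \<otimes>\<^bsub>R\<^esub> y \<oplus>\<^bsub>R\<^esub> x \<otimes>\<^bsub>R\<^esub> v"
    have w: "w \<in> W"
      unfolding w_def by (intro W.a_closed 1 2 3 uv)
    have wc: "w \<in> carrier R"
      using w by (rule W.a_Hcarr)
    have e: "(u \<oplus>\<^bsub>R\<^esub> x) \<otimes>\<^bsub>R\<^esub> (v \<oplus>\<^bsub>R\<^esub> y) = w \<oplus>\<^bsub>R\<^esub> x \<otimes>\<^bsub>R\<^esub> y"
      unfolding w_def using c x y by (simp add: l_distr r_distr a_ac)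
    have "W +>\<^bsub>R\<^esub> w = W"
      by (rule a_coset_join2[OF wc W.a_subgroup w])
    then show ?thesis
      unfolding e using a_coset_add_assoc[OF W.a_subset wc m_closed[OF x y]] by metis
  qed
  have mem: "u \<in> H +>\<^bsub>R\<^esub> z \<longleftrightarrow> (\<exists>h\<in>H. u = h \<oplus>\<^bsub>R\<^esub> z)" for u H z
    by (auto simp: a_r_coset_def')
  have "\<zero>\<^bsub>R\<^esub> \<oplus>\<^bsub>R\<^esub> x \<in> U +>\<^bsub>R\<^esub> x" "\<zero>\<^bsub>R\<^esub> \<oplus>\<^bsub>R\<^esub> y \<in> V +>\<^bsub>R\<^esub> y"
    unfolding mem using U.zero_closed V.zero_closed by blast+
  moreover have "W +>\<^bsub>R\<^esub> (a \<otimes>\<^bsub>R\<^esub> b) = W +>\<^bsub>R\<^esub> (x \<otimes>\<^bsub>R\<^esub> y)"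
    if "a \<in> U +>\<^bsub>R\<^esub> x" "b \<in> V +>\<^bsub>R\<^esub> y" for a b
    using that * unfolding mem by blast
  ultimately show ?thesis
    unfolding rcoset_mult_def by blast
qed

lemma subquotient_simps:
  "carrier (subquotient R V U) = (\<lambda>x. U +>\<^bsub>R\<^esub> x) ` V"
  "zero (subquotient R V U) = U"
  "add (subquotient R V U) = set_add R"
  by (auto simp: subquotient_def FactRing_def)

lemma subquotient_abelian_group:
  assumes "abelian_group R" "additive_subgroup U R" "additive_subgroup V R"
  shows "abelian_group (subquotient R V U)"
proof -
  interpret abelian_group R by fact
  interpret U: abelian_subgroup U R using assms by (simp add: abelian_subgroupI3)
  interpret V: additive_subgroup V R by fact
  have s: "(U +>\<^bsub>R\<^esub> x) <+>\<^bsub>R\<^esub> (U +>\<^bsub>R\<^esub> y) = U +>\<^bsub>R\<^esub> (x \<oplus>\<^bsub>R\<^esub> y)" if "x \<in> V" "y \<in> V" for x y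
    using U.a_rcos_sum that V.a_Hcarr by blast
  show ?thesis
  proof (rule abelian_groupI, goal_cases)
    case (1 x y) then show ?case by (auto simp: subquotient_simps s)
  next
    case 2 then show ?case using a_coset_add_zero[OF U.a_subset] V.zero_closed
      by (force simp: subquotient_simps)
  next
    case (3 x y z) then show ?case by (auto simp: subquotient_simps s a_assoc V.a_Hcarr)
  next
    case (4 x y) then show ?case by (auto simp: subquotient_simps s a_comm V.a_Hcarr)
  next
    case (5 x) then show ?case 
      using s[OF V.zero_closed] a_coset_add_zero[OF U.a_subset] by (auto simp: subquotient_simps V.a_Hcarr)
  next
    case (6 x) 
    then obtain v where v: "v \<in> V" "x = U +>\<^bsub>R\<^esub> v" by (auto simp: subquotient_simps)
    have "(U +>\<^bsub>R\<^esub> \<ominus>\<^bsub>R\<^esub> v) <+>\<^bsub>R\<^esub> x = U"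
      using s[of "\<ominus>\<^bsub>R\<^esub> v" v] v a_coset_add_zero[OF U.a_subset] by (simp add: V.a_Hcarr l_neg)
    moreover have "\<ominus>\<^bsub>R\<^esub> v \<in> V" using v by auto
    ultimately show ?case by (auto simp: subquotient_simps)
  qed
qed

lemma subquotient_left_module:
  assumes "ideal I R" "ideal J1 R" "ideal J2 R" "J1 \<subseteq> J2"
    and "\<And>a x. \<lbrakk>a \<in> I; x \<in> J2\<rbrakk> \<Longrightarrow> a \<otimes>\<^bsub>R\<^esub> x \<in> J1"
  shows "left_module (R Quot I) (subquotient R J2 J1) (rcoset_mult R J1)"
proof -
  interpret I: ideal I R by fact
  interpret J1: ideal J1 R by fact
  interpret J2: ideal J2 R by fact
  have a: "abelian_group R" "ring R" by unfold_locales
  have m: "rcoset_mult R J1 (I +>\<^bsub>R\<^esub> r) (J1 +>\<^bsub>R\<^esub> x) = J1 +>\<^bsub>R\<^esub> (r \<otimes>\<^bsub>R\<^esub> x)"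
    if "r \<in> carrier R" "x \<in> J2" for r x
    using that assms(5) by (intro rcoset_mult_well_defined[OF a(2) I.is_additive_subgroup
      J1.is_additive_subgroup J1.is_additive_subgroup]) (auto simp: J2.a_Hcarr I.a_Hcarr J1.I_l_closed)
  have J2c: "x \<in> carrier R" if "x \<in> J2" for x using that by (rule J2.a_Hcarr)
  have J2m: "r \<otimes>\<^bsub>R\<^esub> x \<in> J2" if "r \<in> carrier R" "x \<in> J2" for r x
    using J2.I_l_closed that by blast
  have A: "\<exists>r\<in>carrier R. b = I +>\<^bsub>R\<^esub> r" if "b \<in> carrier (R Quot I)" for b
    using that by (auto simp: FactRing_simps)
  have M: "\<exists>x\<in>J2. z = J1 +>\<^bsub>R\<^esub> x" if "z \<in> carrier (subquotient R J2 J1)" for z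
    using that by (auto simp: subquotient_simps)
  have ops: "(I +>\<^bsub>R\<^esub> r) \<oplus>\<^bsub>R Quot I\<^esub> (I +>\<^bsub>R\<^esub> r') = I +>\<^bsub>R\<^esub> (r \<oplus>\<^bsub>R\<^esub> r')"
      "(I +>\<^bsub>R\<^esub> r) \<otimes>\<^bsub>R Quot I\<^esub> (I +>\<^bsub>R\<^esub> r') = I +>\<^bsub>R\<^esub> (r \<otimes>\<^bsub>R\<^esub> r')"
    if "r \<in> carrier R" "r' \<in> carrier R" for r r'
    using that by (simp_all add: FactRing_simps I.a_rcos_sum I.rcoset_mult_add)
  have one: "\<one>\<^bsub>R Quot I\<^esub> = I +>\<^bsub>R\<^esub> \<one>\<^bsub>R\<^esub>" by (simp add: FactRing_simps)
  have opM: "(J1 +>\<^bsub>R\<^esub> x) \<oplus>\<^bsub>subquotient R J2 J1\<^esub> (J1 +>\<^bsub>R\<^esub> y) = J1 +>\<^bsub>R\<^esub> (x \<oplus>\<^bsub>R\<^esub> y)"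
    if "x \<in> J2" "y \<in> J2" for x y
    using that by (simp add: subquotient_simps J1.a_rcos_sum J2c)
  have in_M: "J1 +>\<^bsub>R\<^esub> x \<in> carrier (subquotient R J2 J1)" if "x \<in> J2" for x
    using that by (simp add: subquotient_simps)
  show ?thesis
  proof (intro left_module.intro left_module_axioms.intro I.quotient_is_ring
      subquotient_abelian_group[OF a(1) J1.is_additive_subgroup J2.is_additive_subgroup], goal_cases)
    case (1 a b)
    obtain a' where a: "a' \<in> carrier R" "a = I +>\<^bsub>R\<^esub> a'" using A 1(1) by blast
    obtain b' where b: "b' \<in> J2" "b = J1 +>\<^bsub>R\<^esub> b'" using M 1(2) by blast
    show ?case unfolding a(2) b(2)
      using a(1) b(1) by (simp add: ops one opM m J2m J2c in_M I.l_distr I.r_distr I.m_assoc)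
  next
    case (2 a b c)
    obtain a' where a: "a' \<in> carrier R" "a = I +>\<^bsub>R\<^esub> a'" using A 2(1) by blast
    obtain b' where b: "b' \<in> carrier R" "b = I +>\<^bsub>R\<^esub> b'" using A 2(2) by blast
    obtain c' where c: "c' \<in> J2" "c = J1 +>\<^bsub>R\<^esub> c'" using M 2(3) by blast
    show ?case unfolding a(2) b(2) c(2)
      using a(1) b(1) c(1) by (simp add: ops one opM m J2m J2c in_M I.l_distr I.r_distr I.m_assoc)
  next
    case (3 a b c)
    obtain a' where a: "a' \<in> carrier R" "a = I +>\<^bsub>R\<^esub> a'" using A 3(1) by blast
    obtain b' where b: "b' \<in> J2" "b = J1 +>\<^bsub>R\<^esub> b'" using M 3(2) by blast
    obtain c' where c: "c' \<in> J2" "c = J1 +>\<^bsub>R\<^esub> c'" using M 3(3) by blast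
    show ?case unfolding a(2) b(2) c(2)
      using a(1) b(1) c(1) by (simp add: ops one opM m J2m J2c in_M I.l_distr I.r_distr I.m_assoc)
  next
    case (4 a b c)
    obtain a' where a: "a' \<in> carrier R" "a = I +>\<^bsub>R\<^esub> a'" using A 4(1) by blast
    obtain b' where b: "b' \<in> carrier R" "b = I +>\<^bsub>R\<^esub> b'" using A 4(2) by blast
    obtain c' where c: "c' \<in> J2" "c = J1 +>\<^bsub>R\<^esub> c'" using M 4(3) by blast
    show ?case unfolding a(2) b(2) c(2)
      using a(1) b(1) c(1) by (simp add: ops one opM m J2m J2c in_M I.l_distr I.r_distr I.m_assoc)
  next
    case (5 a)
    obtain a' where a: "a' \<in> J2" "a = J1 +>\<^bsub>R\<^esub> a'" using M 5 by blast
    show ?case unfolding a(2)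
      using a(1) by (simp add: ops one opM m J2m J2c in_M I.l_distr I.r_distr I.m_assoc)
  qed
qed

lemma subquotient_right_module:
  assumes "ideal I R" "ideal J1 R" "ideal J2 R" "J1 \<subseteq> J2"
    and "\<And>a x. \<lbrakk>a \<in> I; x \<in> J2\<rbrakk> \<Longrightarrow> x \<otimes>\<^bsub>R\<^esub> a \<in> J1"
  shows "right_module (R Quot I) (subquotient R J2 J1) (rcoset_mult R J1)"
proof -
  interpret I: ideal I R by fact
  interpret J1: ideal J1 R by fact
  interpret J2: ideal J2 R by fact
  have a: "abelian_group R" "ring R" by unfold_locales
  have m: "rcoset_mult R J1 (J1 +>\<^bsub>R\<^esub> x) (I +>\<^bsub>R\<^esub> r) = J1 +>\<^bsub>R\<^esub> (x \<otimes>\<^bsub>R\<^esub> r)"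
    if "r \<in> carrier R" "x \<in> J2" for r x
    using that assms(5) by (intro rcoset_mult_well_defined[OF a(2) J1.is_additive_subgroup
      I.is_additive_subgroup J1.is_additive_subgroup]) (auto simp: J2.a_Hcarr I.a_Hcarr J1.I_r_closed)
  have J2c: "x \<in> carrier R" if "x \<in> J2" for x using that by (rule J2.a_Hcarr)
  have J2m: "x \<otimes>\<^bsub>R\<^esub> r \<in> J2" if "r \<in> carrier R" "x \<in> J2" for r x
    using J2.I_r_closed that by blast
  have A: "\<exists>r\<in>carrier R. b = I +>\<^bsub>R\<^esub> r" if "b \<in> carrier (R Quot I)" for b
    using that by (auto simp: FactRing_simps)
  have M: "\<exists>x\<in>J2. z = J1 +>\<^bsub>R\<^esub> x" if "z \<in> carrier (subquotient R J2 J1)" for z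
    using that by (auto simp: subquotient_simps)
  have ops: "(I +>\<^bsub>R\<^esub> r) \<oplus>\<^bsub>R Quot I\<^esub> (I +>\<^bsub>R\<^esub> r') = I +>\<^bsub>R\<^esub> (r \<oplus>\<^bsub>R\<^esub> r')"
      "(I +>\<^bsub>R\<^esub> r) \<otimes>\<^bsub>R Quot I\<^esub> (I +>\<^bsub>R\<^esub> r') = I +>\<^bsub>R\<^esub> (r \<otimes>\<^bsub>R\<^esub> r')"
    if "r \<in> carrier R" "r' \<in> carrier R" for r r'
    using that by (simp_all add: FactRing_simps I.a_rcos_sum I.rcoset_mult_add)
  have one: "\<one>\<^bsub>R Quot I\<^esub> = I +>\<^bsub>R\<^esub> \<one>\<^bsub>R\<^esub>" by (simp add: FactRing_simps)
  have opM: "(J1 +>\<^bsub>R\<^esub> x) \<oplus>\<^bsub>subquotient R J2 J1\<^esub> (J1 +>\<^bsub>R\<^esub> y) = J1 +>\<^bsub>R\<^esub> (x \<oplus>\<^bsub>R\<^esub> y)"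
    if "x \<in> J2" "y \<in> J2" for x y
    using that by (simp add: subquotient_simps J1.a_rcos_sum J2c)
  have in_M: "J1 +>\<^bsub>R\<^esub> x \<in> carrier (subquotient R J2 J1)" if "x \<in> J2" for x
    using that by (simp add: subquotient_simps)
  show ?thesis
  proof (intro right_module.intro right_module_axioms.intro I.quotient_is_ring
      subquotient_abelian_group[OF a(1) J1.is_additive_subgroup J2.is_additive_subgroup], goal_cases)
    case (1 a b)
    obtain a' where a: "a' \<in> J2" "a = J1 +>\<^bsub>R\<^esub> a'" using M 1(1) by blast
    obtain b' where b: "b' \<in> carrier R" "b = I +>\<^bsub>R\<^esub> b'" using A 1(2) by blast
    show ?case unfolding a(2) b(2)
      using a(1) b(1) by (simp add: ops one opM m J2m J2c in_M I.l_distr I.r_distr I.m_assoc)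
  next
    case (2 a b c)
    obtain a' where a: "a' \<in> J2" "a = J1 +>\<^bsub>R\<^esub> a'" using M 2(1) by blast
    obtain b' where b: "b' \<in> carrier R" "b = I +>\<^bsub>R\<^esub> b'" using A 2(2) by blast
    obtain c' where c: "c' \<in> carrier R" "c = I +>\<^bsub>R\<^esub> c'" using A 2(3) by blast
    show ?case unfolding a(2) b(2) c(2)
      using a(1) b(1) c(1) by (simp add: ops one opM m J2m J2c in_M I.l_distr I.r_distr I.m_assoc)
  next
    case (3 a b c)
    obtain a' where a: "a' \<in> J2" "a = J1 +>\<^bsub>R\<^esub> a'" using M 3(1) by blast
    obtain b' where b: "b' \<in> J2" "b = J1 +>\<^bsub>R\<^esub> b'" using M 3(2) by blast
    obtain c' where c: "c' \<in> carrier R" "c = I +>\<^bsub>R\<^esub> c'" using A 3(3) by blast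
    show ?case unfolding a(2) b(2) c(2)
      using a(1) b(1) c(1) by (simp add: ops one opM m J2m J2c in_M I.l_distr I.r_distr I.m_assoc)
  next
    case (4 a b c)
    obtain a' where a: "a' \<in> J2" "a = J1 +>\<^bsub>R\<^esub> a'" using M 4(1) by blast
    obtain b' where b: "b' \<in> carrier R" "b = I +>\<^bsub>R\<^esub> b'" using A 4(2) by blast
    obtain c' where c: "c' \<in> carrier R" "c = I +>\<^bsub>R\<^esub> c'" using A 4(3) by blast
    show ?case unfolding a(2) b(2) c(2)
      using a(1) b(1) c(1) by (simp add: ops one opM m J2m J2c in_M I.l_distr I.r_distr I.m_assoc)
  next
    case (5 a)
    obtain a' where a: "a' \<in> J2" "a = J1 +>\<^bsub>R\<^esub> a'" using M 5 by blast
    show ?case unfolding a(2)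
      using a(1) by (simp add: ops one opM m J2m J2c in_M I.l_distr I.r_distr I.m_assoc)
  qed
qed

locale left_ideal = additive_subgroup H S + ring S for H and S (structure) +
  assumes left_closed: "\<lbrakk>a \<in> carrier S; x \<in> H\<rbrakk> \<Longrightarrow> a \<otimes> x \<in> H"

definition left_noetherian :: "('a, 'b) ring_scheme \<Rightarrow> bool"
  where "left_noetherian S \<longleftrightarrow> ring S \<and>
    (\<forall>L. (\<forall>n::nat. left_ideal (L n) S) \<and> (\<forall>n. L n \<subseteq> L (Suc n)) \<longrightarrow>
         (\<exists>m. \<forall>n\<ge>m. L n = L m))"

locale nat_filtration = assoc_algebra K R
  for K :: "('k, 'c) ring_scheme" (structure) and R :: "('k, 'a, 'b) module_scheme" (structure) +
  fixes \<Gamma> :: "nat \<Rightarrow> 'a set"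
  assumes subspace: "submodule (\<Gamma> i) K R"
    and ascending: "\<Gamma> i \<subseteq> \<Gamma> (Suc i)"
    and one_mem: "\<one>\<^bsub>R\<^esub> \<in> \<Gamma> 0"
    and exhaustive: "(\<Union>i. \<Gamma> i) = carrier R"
    and mult_mem: "\<lbrakk>x \<in> \<Gamma> i; y \<in> \<Gamma> j\<rbrakk> \<Longrightarrow> x \<otimes>\<^bsub>R\<^esub> y \<in> \<Gamma> (i + j)"

definition fin_dim_subspace ::
    "('k, 'c) ring_scheme \<Rightarrow> ('k, 'a, 'b) module_scheme \<Rightarrow> 'a set \<Rightarrow> bool"
  where "fin_dim_subspace K R V \<longleftrightarrow> submodule V K R \<and>
    (\<exists>B. finite B \<and> B \<subseteq> V \<and>
       (\<forall>v\<in>V. \<exists>c \<in> B \<rightarrow> carrier K. v = (\<Oplus>\<^bsub>R\<^esub>b\<in>B. c b \<odot>\<^bsub>R\<^esub> b)))"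

definition finite_nat_filtration ::
    "('k, 'c) ring_scheme \<Rightarrow> ('k, 'a, 'b) module_scheme \<Rightarrow> (nat \<Rightarrow> 'a set) \<Rightarrow> bool"
  where "finite_nat_filtration K R \<Gamma> \<longleftrightarrow>
    nat_filtration K R \<Gamma> \<and> (\<forall>i. fin_dim_subspace K R (\<Gamma> i))"

definition filt_pred :: "('a, 'b) ring_scheme \<Rightarrow> (nat \<Rightarrow> 'a set) \<Rightarrow> nat \<Rightarrow> 'a set"
  where "filt_pred R \<Gamma> n = (case n of 0 \<Rightarrow> {\<zero>\<^bsub>R\<^esub>} | Suc m \<Rightarrow> \<Gamma> m)"

text \<open>
  An element of the associated graded ring is the finitely supported family \<open>f\<close> of its
  homogeneous components \<open>f n \<in> \<Gamma>\<^sub>n/\<Gamma>\<^sub>n\<^sub>-\<^sub>1\<close>. The product of the homogeneous elements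
  \<open>\<Gamma>\<^sub>i\<^sub>-\<^sub>1 + x\<close> and \<open>\<Gamma>\<^sub>j\<^sub>-\<^sub>1 + y\<close> is \<open>\<Gamma>\<^sub>i\<^sub>+\<^sub>j\<^sub>-\<^sub>1 + xy\<close>, which is their
  \<^const>\<open>rcoset_mult\<close> modulo \<open>\<Gamma>\<^sub>i\<^sub>+\<^sub>j\<^sub>-\<^sub>1\<close>.
\<close>

definition assoc_graded :: "('a, 'b) ring_scheme \<Rightarrow> (nat \<Rightarrow> 'a set) \<Rightarrow> (nat \<Rightarrow> 'a set) ring"
  where "assoc_graded R \<Gamma> =
   \<lparr>carrier = {f. (\<forall>n. f n \<in> carrier (subquotient R (\<Gamma> n) (filt_pred R \<Gamma> n))) \<and>
                  finite {n. f n \<noteq> filt_pred R \<Gamma> n}},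
    mult = (\<lambda>f g n. \<Oplus>\<^bsub>subquotient R (\<Gamma> n) (filt_pred R \<Gamma> n)\<^esub>i\<in>{..n}.
                      rcoset_mult R (filt_pred R \<Gamma> n) (f i) (g (n - i))),
    one = (\<lambda>n. filt_pred R \<Gamma> n +>\<^bsub>R\<^esub> (if n = 0 then \<one>\<^bsub>R\<^esub> else \<zero>\<^bsub>R\<^esub>)),
    zero = (\<lambda>n. filt_pred R \<Gamma> n),
    add = (\<lambda>f g n. f n \<oplus>\<^bsub>subquotient R (\<Gamma> n) (filt_pred R \<Gamma> n)\<^esub> g n)\<rparr>"

text \<open>
  The associated graded ring is a ring: it is the image of the Rees subring
  \<open>{\<Sum> p\<^sub>n X\<^sup>n. p\<^sub>n \<in> \<Gamma>\<^sub>n}\<close> of the polynomial ring \<open>R[X]\<close>.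
\<close>

locale ring_filtration = ring R for R (structure) +
  fixes \<Gamma> :: "nat \<Rightarrow> 'a set"
  assumes filt_add_subgroup: "additive_subgroup (\<Gamma> i) R"
    and ascending: "\<Gamma> i \<subseteq> \<Gamma> (Suc i)"
    and one_mem: "\<one>\<^bsub>R\<^esub> \<in> \<Gamma> 0"
    and mult_mem: "\<lbrakk>x \<in> \<Gamma> i; y \<in> \<Gamma> j\<rbrakk> \<Longrightarrow> x \<otimes>\<^bsub>R\<^esub> y \<in> \<Gamma> (i + j)"
begin

lemma pred_add_subgroup: "additive_subgroup (filt_pred R \<Gamma> n) R"
proof (cases n)
  case 0
  then show ?thesis using zeroideal ideal.axioms(1) by (fastforce simp: filt_pred_def)
qed (simp add: filt_pred_def filt_add_subgroup)

lemma pred_subset: "filt_pred R \<Gamma> n \<subseteq> \<Gamma> n"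
  using ascending additive_subgroup.zero_closed[OF filt_add_subgroup]
  by (cases n) (auto simp: filt_pred_def)

lemma filt_mem_carrier: "x \<in> \<Gamma> n \<Longrightarrow> x \<in> carrier R"
  using additive_subgroup.a_subset[OF filt_add_subgroup] by blast

lemma filt_mono: "m \<le> n \<Longrightarrow> \<Gamma> m \<subseteq> \<Gamma> n"
  using ascending by (rule lift_Suc_mono_le)

lemma pred_mult_left:
  assumes "x \<in> filt_pred R \<Gamma> i" "y \<in> \<Gamma> j" shows "x \<otimes>\<^bsub>R\<^esub> y \<in> filt_pred R \<Gamma> (i + j)"
proof (cases i)
  case 0
  then show ?thesis using assms additive_subgroup.zero_closed[OF pred_add_subgroup] filt_mem_carrier
    by (auto simp: filt_pred_def[of _ _ 0])
next
  case (Suc k) then show ?thesis using assms mult_mem[of x k y j] by (simp add: filt_pred_def)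
qed

lemma pred_mult_right:
  assumes "x \<in> \<Gamma> i" "y \<in> filt_pred R \<Gamma> j" shows "x \<otimes>\<^bsub>R\<^esub> y \<in> filt_pred R \<Gamma> (i + j)"
proof (cases j)
  case 0
  then show ?thesis using assms additive_subgroup.zero_closed[OF pred_add_subgroup] filt_mem_carrier
    by (auto simp: filt_pred_def[of _ _ 0])
next
  case (Suc k) then show ?thesis using assms mult_mem[of x i y k] by (simp add: filt_pred_def)
qed

lemma graded_mult_coset:
  assumes "x \<in> \<Gamma> i" "y \<in> \<Gamma> j"
  shows "rcoset_mult R (filt_pred R \<Gamma> (i + j)) (filt_pred R \<Gamma> i +>\<^bsub>R\<^esub> x) (filt_pred R \<Gamma> j +>\<^bsub>R\<^esub> y)
       = filt_pred R \<Gamma> (i + j) +>\<^bsub>R\<^esub> (x \<otimes>\<^bsub>R\<^esub> y)"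
proof (rule rcoset_mult_well_defined[OF ring_axioms pred_add_subgroup pred_add_subgroup
      pred_add_subgroup filt_mem_carrier[OF assms(1)] filt_mem_carrier[OF assms(2)]])
  show "u \<otimes>\<^bsub>R\<^esub> y \<in> filt_pred R \<Gamma> (i + j)" if "u \<in> filt_pred R \<Gamma> i" for u
    using that assms(2) by (rule pred_mult_left)
  show "x \<otimes>\<^bsub>R\<^esub> v \<in> filt_pred R \<Gamma> (i + j)" if "v \<in> filt_pred R \<Gamma> j" for v
    using assms(1) that by (rule pred_mult_right)
  show "u \<otimes>\<^bsub>R\<^esub> v \<in> filt_pred R \<Gamma> (i + j)"
    if "u \<in> filt_pred R \<Gamma> i" "v \<in> filt_pred R \<Gamma> j" for u v
    using that(1) subsetD[OF pred_subset that(2)] by (rule pred_mult_left)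
qed

abbreviation "graded_comp n \<equiv> subquotient R (\<Gamma> n) (filt_pred R \<Gamma> n)"

lemma comp_group: "abelian_group (graded_comp n)"
  by (rule subquotient_abelian_group[OF is_abelian_group pred_add_subgroup filt_add_subgroup])

lemma mult_mem_conv:
  assumes "\<forall>n. f n \<in> \<Gamma> n" "\<forall>n. g n \<in> \<Gamma> n" "i \<in> {..n}"
  shows "f i \<otimes>\<^bsub>R\<^esub> g (n - i) \<in> \<Gamma> n"
  using mult_mem[of "f i" i "g (n - i)" "n - i"] assms by simp

lemma finsum_coset:
  assumes "\<And>i. i \<in> A \<Longrightarrow> x i \<in> \<Gamma> n" "finite A"
  shows "(\<Oplus>\<^bsub>graded_comp n\<^esub>i\<in>A. filt_pred R \<Gamma> n +>\<^bsub>R\<^esub> x i) = filt_pred R \<Gamma> n +>\<^bsub>R\<^esub> (\<Oplus>\<^bsub>R\<^esub>i\<in>A. x i)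
       \<and> (\<Oplus>\<^bsub>R\<^esub>i\<in>A. x i) \<in> \<Gamma> n"
  using assms(2,1)
proof (induction A rule: finite_induct)
  case empty
  interpret C: abelian_group "graded_comp n" by (rule comp_group)
  interpret V: additive_subgroup "\<Gamma> n" R by (rule filt_add_subgroup)
  interpret U: additive_subgroup "filt_pred R \<Gamma> n" R by (rule pred_add_subgroup)
  show ?case using a_coset_add_zero[OF U.a_subset] by (simp add: subquotient_simps)
next
  case (insert a A)
  interpret C: abelian_group "graded_comp n" by (rule comp_group)
  interpret V: additive_subgroup "\<Gamma> n" R by (rule filt_add_subgroup)
  interpret U: abelian_subgroup "filt_pred R \<Gamma> n" R
    by (simp add: abelian_subgroupI3 pred_add_subgroup is_abelian_group)
  have "(\<Oplus>\<^bsub>graded_comp n\<^esub>i\<in>insert a A. filt_pred R \<Gamma> n +>\<^bsub>R\<^esub> x i)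
    = (filt_pred R \<Gamma> n +>\<^bsub>R\<^esub> x a) \<oplus>\<^bsub>graded_comp n\<^esub> (\<Oplus>\<^bsub>graded_comp n\<^esub>i\<in>A. filt_pred R \<Gamma> n +>\<^bsub>R\<^esub> x i)"
    using insert by (intro C.finsum_insert) (auto simp: subquotient_simps)
  moreover have "(\<Oplus>\<^bsub>R\<^esub>i\<in>insert a A. x i) = x a \<oplus>\<^bsub>R\<^esub> (\<Oplus>\<^bsub>R\<^esub>i\<in>A. x i)"
    using insert filt_mem_carrier by (intro finsum_insert) (auto)
  ultimately show ?case using insert
    by (simp add: subquotient_simps U.a_rcos_sum filt_mem_carrier)
qed

abbreviation "to_graded p \<equiv> (\<lambda>n. filt_pred R \<Gamma> n +>\<^bsub>R\<^esub> p n)"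
abbreviation "rees \<equiv> {p \<in> carrier (UP R). \<forall>n. p n \<in> \<Gamma> n}"

lemma rees_subring: "subring rees (UP R)"
proof -
  have UP: "UP_ring R" by (simp add: UP_ring_def ring_axioms)
  interpret P: ring "UP R" by (rule UP_ring.UP_ring[OF UP])
  have z: "\<zero>\<^bsub>R\<^esub> \<in> \<Gamma> n" for n by (simp add: additive_subgroup.zero_closed[OF filt_add_subgroup])
  have coeff: "coeff (UP R) p n = p n" if "p \<in> carrier (UP R)" for p n
    using that by (simp add: UP_def)
  have up: "p n \<in> carrier R" if "p \<in> carrier (UP R)" for p n
    using that by (simp add: UP_def mem_upD)
  show ?thesis
  proof (rule P.subringI)
    have "\<one>\<^bsub>UP R\<^esub> n \<in> \<Gamma> n" for n
      using z one_mem by (simp add: UP_def)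
    then show "\<one>\<^bsub>UP R\<^esub> \<in> rees" using P.one_closed by blast
  next
    fix h assume h: "h \<in> rees"
    then have hP: "h \<in> carrier (UP R)" by blast
    have "(\<ominus>\<^bsub>UP R\<^esub> h) n \<in> \<Gamma> n" for n
      using UP_ring.coeff_a_inv[OF UP hP, of n] coeff[OF hP] coeff[OF P.a_inv_closed[OF hP]] h
        additive_subgroup.a_inv_closed[OF filt_add_subgroup, of "h n" n] by simp
    then show "\<ominus>\<^bsub>UP R\<^esub> h \<in> rees" using P.a_inv_closed[OF hP] by blast
  next
    fix f g assume fg: "f \<in> rees" "g \<in> rees"
    then have P: "f \<in> carrier (UP R)" "g \<in> carrier (UP R)" by blast+
    have "(f \<otimes>\<^bsub>UP R\<^esub> g) n = (\<Oplus>\<^bsub>R\<^esub>i\<in>{..n}. f i \<otimes>\<^bsub>R\<^esub> g (n - i))" for n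
      using P by (simp add: UP_def)
    moreover have "(\<Oplus>\<^bsub>R\<^esub>i\<in>{..n}. f i \<otimes>\<^bsub>R\<^esub> g (n - i)) \<in> \<Gamma> n" for n
      using fg by (intro conjunct2[OF finsum_coset]) (simp_all add: mult_mem_conv)
    ultimately show "f \<otimes>\<^bsub>UP R\<^esub> g \<in> rees" using P.m_closed[OF P] by simp
    have "(f \<oplus>\<^bsub>UP R\<^esub> g) n = f n \<oplus>\<^bsub>R\<^esub> g n" for n
      using P by (simp add: UP_def)
    then show "f \<oplus>\<^bsub>UP R\<^esub> g \<in> rees"
      using P.a_closed[OF P] fg additive_subgroup.a_closed[OF filt_add_subgroup] by simp
  qed blast
qed

lemma coset_eq_pred_iff: "x \<in> carrier R \<Longrightarrow> filt_pred R \<Gamma> n +>\<^bsub>R\<^esub> x = filt_pred R \<Gamma> n \<longleftrightarrow> x \<in> filt_pred R \<Gamma> n"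
  using a_coset_join1[OF _ _ additive_subgroup.a_subgroup[OF pred_add_subgroup]]
    a_coset_join2[OF _ additive_subgroup.a_subgroup[OF pred_add_subgroup]] by blast

lemma coset_zero: "filt_pred R \<Gamma> n +>\<^bsub>R\<^esub> \<zero>\<^bsub>R\<^esub> = filt_pred R \<Gamma> n"
  by (rule a_coset_add_zero[OF additive_subgroup.a_subset[OF pred_add_subgroup]])

lemma phi_image: "to_graded ` rees = carrier (assoc_graded R \<Gamma>)"
proof (intro subset_antisym subsetI)
  fix f assume "f \<in> to_graded ` rees"
  then obtain p where p: "p \<in> rees" "f = to_graded p" by blast
  then have "p \<in> up R" by (simp add: UP_def)
  then obtain N where "bound \<zero>\<^bsub>R\<^esub> N p" by (auto simp: up_def)
  then have N: "p n = \<zero>\<^bsub>R\<^esub>" if "n > N" for n using that by (auto simp: bound_def)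
  have fN: "f n = filt_pred R \<Gamma> n" if "n > N" for n
    using N[OF that] p(2) by (simp add: coset_zero)
  have "{n. f n \<noteq> filt_pred R \<Gamma> n} \<subseteq> {..N}"
  proof
    fix n assume "n \<in> {n. f n \<noteq> filt_pred R \<Gamma> n}"
    then show "n \<in> {..N}" using fN[of n] by (cases "n > N") simp_all
  qed
  then have fin: "finite {n. f n \<noteq> filt_pred R \<Gamma> n}"
    using finite_atMost by (rule finite_subset)
  have "f n \<in> (\<lambda>x. filt_pred R \<Gamma> n +>\<^bsub>R\<^esub> x) ` \<Gamma> n" for n
    using p by blast
  with fin show "f \<in> carrier (assoc_graded R \<Gamma>)"
    by (simp add: assoc_graded_def subquotient_simps)
next
  fix f assume f: "f \<in> carrier (assoc_graded R \<Gamma>)"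
  then have "\<forall>n. \<exists>x. x \<in> \<Gamma> n \<and> f n = filt_pred R \<Gamma> n +>\<^bsub>R\<^esub> x \<and> (f n = filt_pred R \<Gamma> n \<longrightarrow> x = \<zero>\<^bsub>R\<^esub>)"
  proof (intro allI)
    fix n show "\<exists>x. x \<in> \<Gamma> n \<and> f n = filt_pred R \<Gamma> n +>\<^bsub>R\<^esub> x \<and> (f n = filt_pred R \<Gamma> n \<longrightarrow> x = \<zero>\<^bsub>R\<^esub>)"
    proof (cases "f n = filt_pred R \<Gamma> n")
      case True
      then show ?thesis
        by (intro exI[of _ "\<zero>\<^bsub>R\<^esub>"])
          (simp add: coset_zero additive_subgroup.zero_closed[OF filt_add_subgroup])
    next
      case False
      have "f n \<in> (\<lambda>x. filt_pred R \<Gamma> n +>\<^bsub>R\<^esub> x) ` \<Gamma> n"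
        using f by (simp add: assoc_graded_def subquotient_simps)
      then show ?thesis using False by blast
    qed
  qed
  then obtain p where p: "\<And>n. p n \<in> \<Gamma> n" "\<And>n. f n = filt_pred R \<Gamma> n +>\<^bsub>R\<^esub> p n"
     "\<And>n. f n = filt_pred R \<Gamma> n \<Longrightarrow> p n = \<zero>\<^bsub>R\<^esub>" by metis
  have "finite {n. f n \<noteq> filt_pred R \<Gamma> n}" using f by (simp add: assoc_graded_def)
  then obtain N where "{n. f n \<noteq> filt_pred R \<Gamma> n} \<subseteq> {..N}" using finite_nat_iff_bounded_le by blast
  then have "p n = \<zero>\<^bsub>R\<^esub>" if "N < n" for n
    using p(3)[of n] that by (metis (mono_tags, lifting) atMost_iff mem_Collect_eq not_le subsetD)
  then have "bound \<zero>\<^bsub>R\<^esub> N p" by (rule bound.intro)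
  then have "p \<in> up R" using filt_mem_carrier[OF p(1)] by (intro mem_upI exI)
  then have "p \<in> rees" using p(1) by (simp add: UP_def)
  moreover have "f = to_graded p" using p(2) by auto
  ultimately show "f \<in> to_graded ` rees" by blast
qed

theorem assoc_graded_ring: "ring (assoc_graded R \<Gamma>)"
proof -
  have UP: "UP_ring R" by (simp add: UP_ring_def ring_axioms)
  interpret P: ring "UP R" by (rule UP_ring.UP_ring[OF UP])
  interpret S: ring "(UP R)\<lparr>carrier := rees\<rparr>" by (rule P.subring_is_ring[OF rees_subring])
  have "to_graded \<in> ring_hom ((UP R)\<lparr>carrier := rees\<rparr>) (assoc_graded R \<Gamma>)"
  proof (rule ring_hom_memI, goal_cases)
    case (1 p)
    then have "to_graded p \<in> to_graded ` rees" by simp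
    then show ?case by (simp only: phi_image)
  next
    case (2 p q)
    show ?case
    proof
      fix n
      have "(\<Oplus>\<^bsub>graded_comp n\<^esub>i\<in>{..n}. rcoset_mult R (filt_pred R \<Gamma> n) (to_graded p i) (to_graded q (n - i)))
          = (\<Oplus>\<^bsub>graded_comp n\<^esub>i\<in>{..n}. filt_pred R \<Gamma> n +>\<^bsub>R\<^esub> (p i \<otimes>\<^bsub>R\<^esub> q (n - i)))"
      proof (rule abelian_monoid.finsum_cong'[OF abelian_group.axioms(1)[OF comp_group] refl])
        show "(\<lambda>i. filt_pred R \<Gamma> n +>\<^bsub>R\<^esub> p i \<otimes>\<^bsub>R\<^esub> q (n - i)) \<in> {..n} \<rightarrow> carrier (graded_comp n)"
          using 2 by (simp add: subquotient_simps mult_mem_conv)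
      next
        fix i assume "i \<in> {..n}"
        then show "rcoset_mult R (filt_pred R \<Gamma> n) (to_graded p i) (to_graded q (n - i)) = filt_pred R \<Gamma> n +>\<^bsub>R\<^esub> (p i \<otimes>\<^bsub>R\<^esub> q (n - i))"
          using graded_mult_coset[of "p i" i "q (n - i)" "n - i"] 2 by simp
      qed
      also have "\<dots> = filt_pred R \<Gamma> n +>\<^bsub>R\<^esub> (\<Oplus>\<^bsub>R\<^esub>i\<in>{..n}. p i \<otimes>\<^bsub>R\<^esub> q (n - i))"
        using 2 by (intro conjunct1[OF finsum_coset]) (simp_all add: mult_mem_conv)
      finally show "to_graded (p \<otimes>\<^bsub>UP R\<lparr>carrier := rees\<rparr>\<^esub> q) n = (to_graded p \<otimes>\<^bsub>assoc_graded R \<Gamma>\<^esub> to_graded q) n"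
        using 2 by (simp add: assoc_graded_def UP_def)
    qed
  next
    case (3 p q)
    show ?case
    proof
      fix n
      interpret U: abelian_subgroup "filt_pred R \<Gamma> n" R
        by (simp add: abelian_subgroupI3 pred_add_subgroup is_abelian_group)
      show "to_graded (p \<oplus>\<^bsub>UP R\<lparr>carrier := rees\<rparr>\<^esub> q) n = (to_graded p \<oplus>\<^bsub>assoc_graded R \<Gamma>\<^esub> to_graded q) n"
        using 3 by (simp add: assoc_graded_def UP_def subquotient_simps U.a_rcos_sum mem_upD)
    qed
  next
    case 4
    show ?case by (simp add: assoc_graded_def UP_def)
  qed
  from S.ring_hom_imp_img_ring[OF this]
  have *: "ring ((assoc_graded R \<Gamma>)\<lparr>carrier := to_graded ` rees, zero := to_graded \<zero>\<^bsub>UP R\<^esub>\<rparr>)" by simp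
  have z: "to_graded \<zero>\<^bsub>UP R\<^esub> = zero (assoc_graded R \<Gamma>)"
    by (simp add: assoc_graded_def UP_def coset_zero)
  show ?thesis using * unfolding z phi_image by simp
qed

end

lemma (in nat_filtration) ring_filtration: "ring_filtration R \<Gamma>"
proof (intro ring_filtration.intro ring_filtration_axioms.intro)
  show "additive_subgroup (\<Gamma> i) R" for i
    using subspace[of i] by (simp add: submodule_def additive_subgroupI)
qed (rule ring_axioms ascending one_mem mult_mem; assumption)+

theorem (in nat_filtration) assoc_graded_ring: "ring (assoc_graded R \<Gamma>)"
  by (rule ring_filtration.assoc_graded_ring[OF ring_filtration])

end

theory Submission
  imports Defs Complex_Main
begin

text \<open>
  Suppose that \<open>\<Gamma>\<close> is a finite filtration whose associated graded ring is left noetherian,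
  and let \<open>f n\<close> be the dimension of \<open>\<Gamma>\<^sub>n\<close> modulo \<open>I\<close>. The dimension of
  \<open>J\<^sub>2 \<inter> \<Gamma>\<^sub>n\<close> modulo \<open>J\<^sub>1\<close> can be estimated from both sides of the bimodule
  \<open>J\<^sub>2/J\<^sub>1\<close>.

  From the left: the symbols of the elements of \<open>J\<^sub>2\<close> form a finitely generated left ideal, so
  there are finitely many \<open>x\<^sub>i\<close> of degree \<open>n\<^sub>i\<close> with
  \<open>J\<^sub>2 \<inter> \<Gamma>\<^sub>n = \<Sum>\<^sub>i \<Gamma>\<^bsub>n-n\<^sub>i\<^esub> x\<^sub>i\<close> for all \<open>n\<close>
  (\<open>ideal_finitely_spanned\<close>). Writing each \<open>x\<^sub>i\<close> in terms of the \<open>s\<close> left generators bounds the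
  dimension by \<open>s f (n + c)\<close> for a constant \<open>c\<close> (\<open>left_generators_dim_upper_bound\<close>). From the right:
  if the \<open>t\<close> basis elements lie in \<open>\<Gamma>\<^sub>d\<close>, their products with \<open>\<Gamma>\<^sub>n\<close> lie in
  \<open>\<Gamma>\<^bsub>n+d\<^esub>\<close>, and they contribute \<open>t f n\<close> independent dimensions
  (\<open>right_independent_dim_lower_bound\<close>). Hence \<open>t f n \<le> s f (n + d + c)\<close> for all \<open>n\<close>. As
  \<open>f 0 > 0\<close>, the sequence \<open>f\<close>, and with it \<open>dim \<Gamma>\<^sub>n\<close>, would grow exponentially if
  \<open>s < t\<close>.

  Exponential growth contradicts left noetherianity by an argument of Stephenson and Zhang
  (\<open>filt_dim_subexponential\<close>). If \<open>dim \<Gamma>\<^sub>n\<close> is not \<open>O(\<beta>\<^sup>n)\<close> for some \<open>\<beta> > 1\<close>,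
  one can choose elements \<open>x\<^sub>1, x\<^sub>2, \<dots>\<close> in degrees \<open>n\<^sub>1, n\<^sub>2, \<dots>\<close> that
  are so sparse that \<open>1/\<beta> + \<Sum>\<^sub>i 1/\<beta>\<^bsup>n\<^sub>i\<^esup> < 1\<close>. At every stage some degree \<open>n\<close>
  satisfies \<open>dim \<Gamma>\<^sub>n > dim \<Gamma>\<^bsub>n-1\<^esub> + \<Sum>\<^sub>i dim \<Gamma>\<^bsub>n-n\<^sub>i\<^esub>\<close>, since
  otherwise this recursive inequality, reversed, would bound \<open>dim \<Gamma>\<^sub>n\<close> by a multiple of
  \<open>\<beta>\<^sup>n\<close>. So \<open>\<Gamma>\<^sub>n\<close> has an element whose symbol lies outside the left ideal generated by the
  symbols of the previous elements, and these left ideals form a strictly ascending chain.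

  Both uses of the noetherian condition are instances of \<open>noetherian_saturated_list\<close>: a process that
  extends a finite list of elements by one with a new symbol has to stop.
\<close>

section \<open>Dimension of a subspace modulo another\<close>

locale module_over_field = K: field K + module K M for K and M (structure)
begin

lemma subspace_zero: "submodule V K M \<Longrightarrow> \<zero> \<in> V"
  using subgroup.one_closed[OF submodule.axioms(1)] by fastforce

lemma subspace_carrier: "submodule V K M \<Longrightarrow> x \<in> V \<Longrightarrow> x \<in> carrier M"
  using submoduleE(1) by blast

lemma subspace_diff: "submodule V K M \<Longrightarrow> x \<in> V \<Longrightarrow> y \<in> V \<Longrightarrow> x \<ominus> y \<in> V"
  by (simp add: a_minus_def submoduleE)

lemma subspace_trivial: "submodule {\<zero>} K M"
  by (rule submoduleI) (auto simp: smult_r_null)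

lemma subspace_Int: "submodule V K M \<Longrightarrow> submodule W K M \<Longrightarrow> submodule (V \<inter> W) K M"
  by (rule submoduleI) (auto simp: submoduleE subspace_zero subspace_carrier)

definition line_extension :: "'c set \<Rightarrow> 'c \<Rightarrow> 'c set"
  where "line_extension U x = {u \<oplus> a \<odot> x | u a. u \<in> U \<and> a \<in> carrier K}"

primrec adjoin :: "'c set \<Rightarrow> 'c list \<Rightarrow> 'c set"
  where
    "adjoin U [] = U"
  | "adjoin U (x # xs) = line_extension (adjoin U xs) x"

lemma line_extension_memI:
  "\<lbrakk>u \<in> U; a \<in> carrier K; y = u \<oplus> a \<odot> x\<rbrakk> \<Longrightarrow> y \<in> line_extension U x"
  by (auto simp: line_extension_def)

lemma line_extensionE:
  assumes "y \<in> line_extension U x"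
  obtains u a where "u \<in> U" "a \<in> carrier K" "y = u \<oplus> a \<odot> x"
  using assms unfolding line_extension_def by blast

lemma line_extension_subspace:
  assumes U: "submodule U K M" and x: "x \<in> carrier M"
  shows "submodule (line_extension U x) K M"
proof (rule submoduleI)
  note c = subspace_carrier[OF U]
  show "line_extension U x \<subseteq> carrier M"
    using c x by (auto simp: line_extension_def)
  show "\<zero> \<in> line_extension U x"
    using subspace_zero[OF U] x by (intro line_extension_memI[of "\<zero>" _ "\<zero>\<^bsub>K\<^esub>"]) auto
  show "\<ominus> y \<in> line_extension U x" if y: "y \<in> line_extension U x" for y
  proof -
    obtain u a where "u \<in> U" "a \<in> carrier K" "y = u \<oplus> a \<odot> x"
      using y by (elim line_extensionE)
    then show ?thesis
      using submoduleE(3)[OF U] x c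
      by (intro line_extension_memI[of "\<ominus> u" _ "\<ominus>\<^bsub>K\<^esub> a"]) (auto simp: smult_l_minus minus_add)
  qed
  show "y \<oplus> z \<in> line_extension U x" if yz: "y \<in> line_extension U x" "z \<in> line_extension U x" for y z
  proof -
    obtain u a v b where "u \<in> U" "a \<in> carrier K" "y = u \<oplus> a \<odot> x"
      "v \<in> U" "b \<in> carrier K" "z = v \<oplus> b \<odot> x"
      using yz by (elim line_extensionE)
    then show ?thesis
      using submoduleE(5)[OF U] x c
      by (intro line_extension_memI[of "u \<oplus> v" _ "a \<oplus>\<^bsub>K\<^esub> b"]) (auto simp: smult_l_distr M.a_ac)
  qed
  show "b \<odot> y \<in> line_extension U x" if b: "b \<in> carrier K" and y: "y \<in> line_extension U x" for b y
  proof -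
    obtain u a where "u \<in> U" "a \<in> carrier K" "y = u \<oplus> a \<odot> x"
      using y by (elim line_extensionE)
    then show ?thesis
      using submoduleE(4)[OF U b] x c b
      by (intro line_extension_memI[of "b \<odot> u" _ "b \<otimes>\<^bsub>K\<^esub> a"])
        (auto simp: smult_r_distr smult_assoc1)
  qed
qed

lemma line_extension_base: "submodule U K M \<Longrightarrow> x \<in> carrier M \<Longrightarrow> U \<subseteq> line_extension U x"
  using subspace_carrier
  by (auto intro!: line_extension_memI[where a = "\<zero>\<^bsub>K\<^esub>"] simp: smult_l_null)

lemma line_extension_mono: "U \<subseteq> V \<Longrightarrow> line_extension U x \<subseteq> line_extension V x"
  by (auto simp: line_extension_def)

lemma adjoin_subspace:
  "submodule U K M \<Longrightarrow> set xs \<subseteq> carrier M \<Longrightarrow> submodule (adjoin U xs) K M"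
  by (induction xs) (auto simp: line_extension_subspace)

lemma adjoin_base: "submodule U K M \<Longrightarrow> set xs \<subseteq> carrier M \<Longrightarrow> U \<subseteq> adjoin U xs"
  using line_extension_base adjoin_subspace by (induction xs) (simp, fastforce)

lemma adjoin_mono: "U \<subseteq> V \<Longrightarrow> adjoin U xs \<subseteq> adjoin V xs"
  by (induction xs) (auto dest: line_extension_mono)

lemma adjoin_append: "adjoin U (xs @ ys) = adjoin (adjoin U ys) xs"
  by (induction xs) auto

lemma adjoin_add:
  assumes "submodule U K M" "submodule V K M" "U \<subseteq> V" "set xs \<subseteq> carrier M"
  shows "x \<in> adjoin U xs \<Longrightarrow> y \<in> V \<Longrightarrow> x \<oplus> y \<in> adjoin V xs"
  using assms(4)
proof (induction xs arbitrary: x)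
  case Nil
  then show ?case using assms submoduleE(5)[OF assms(2)] by auto
next
  case (Cons z zs)
  obtain u a where u: "u \<in> adjoin U zs" "a \<in> carrier K" "x = u \<oplus> a \<odot> z"
    using Cons.prems by (auto simp: line_extension_def)
  have "u \<in> carrier M" "y \<in> carrier M"
    using u(1) Cons.prems subspace_carrier[OF adjoin_subspace[OF assms(1)]]
      subspace_carrier[OF assms(2)] by auto
  then have "x \<oplus> y = (u \<oplus> y) \<oplus> a \<odot> z"
    using u Cons.prems by (simp add: M.a_ac)
  moreover have "u \<oplus> y \<in> adjoin V zs"
    using Cons u by simp
  ultimately show ?case
    using u(2) by (auto intro: line_extension_memI)
qed

lemma set_add_iff: "z \<in> A <+>\<^bsub>M\<^esub> B \<longleftrightarrow> (\<exists>a\<in>A. \<exists>b\<in>B. z = a \<oplus> b)"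
  by (auto simp: set_add_def')

lemma set_add_subspace:
  assumes V: "submodule V K M" and W: "submodule W K M"
  shows "submodule (V <+>\<^bsub>M\<^esub> W) K M"
proof (rule submoduleI)
  note c = subspace_carrier[OF V] subspace_carrier[OF W]
  show "V <+>\<^bsub>M\<^esub> W \<subseteq> carrier M"
    using c by (auto simp: set_add_iff)
  show "\<zero> \<in> V <+>\<^bsub>M\<^esub> W"
    using subspace_zero[OF V] subspace_zero[OF W] by (force simp: set_add_iff)
  show "\<ominus> x \<in> V <+>\<^bsub>M\<^esub> W" if x: "x \<in> V <+>\<^bsub>M\<^esub> W" for x
  proof -
    obtain v w where "v \<in> V" "w \<in> W" "x = v \<oplus> w"
      using x by (auto simp: set_add_iff)
    then have "\<ominus> v \<in> V" "\<ominus> w \<in> W" "\<ominus> x = \<ominus> v \<oplus> \<ominus> w"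
      using submoduleE(3)[OF V] submoduleE(3)[OF W] c by (auto simp: minus_add)
    then show ?thesis by (auto simp: set_add_iff)
  qed
  show "x \<oplus> y \<in> V <+>\<^bsub>M\<^esub> W" if xy: "x \<in> V <+>\<^bsub>M\<^esub> W" "y \<in> V <+>\<^bsub>M\<^esub> W" for x y
  proof -
    obtain v w v' w' where "v \<in> V" "w \<in> W" "x = v \<oplus> w" "v' \<in> V" "w' \<in> W" "y = v' \<oplus> w'"
      using xy by (auto simp: set_add_iff)
    then have "v \<oplus> v' \<in> V" "w \<oplus> w' \<in> W" "x \<oplus> y = (v \<oplus> v') \<oplus> (w \<oplus> w')"
      using submoduleE(5)[OF V] submoduleE(5)[OF W] c by (auto simp: M.a_ac)
    then show ?thesis by (auto simp: set_add_iff)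
  qed
  show "a \<odot> x \<in> V <+>\<^bsub>M\<^esub> W" if a: "a \<in> carrier K" and x: "x \<in> V <+>\<^bsub>M\<^esub> W" for a x
  proof -
    obtain v w where "v \<in> V" "w \<in> W" "x = v \<oplus> w"
      using x by (auto simp: set_add_iff)
    then have "a \<odot> v \<in> V" "a \<odot> w \<in> W" "a \<odot> x = a \<odot> v \<oplus> a \<odot> w"
      using submoduleE(4)[OF V a] submoduleE(4)[OF W a] c a by (auto simp: smult_r_distr)
    then show ?thesis by (auto simp: set_add_iff)
  qed
qed

lemma set_add_left: "submodule V K M \<Longrightarrow> submodule W K M \<Longrightarrow> V \<subseteq> V <+>\<^bsub>M\<^esub> W"
  using subspace_zero[of W] subspace_carrier by (force simp: set_add_iff)

lemma set_add_right: "submodule V K M \<Longrightarrow> submodule W K M \<Longrightarrow> W \<subseteq> V <+>\<^bsub>M\<^esub> W"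
  using subspace_zero[of V] subspace_carrier by (force simp: set_add_iff)

lemma set_add_least:
  "\<lbrakk>V \<subseteq> W; V' \<subseteq> W; submodule W K M\<rbrakk> \<Longrightarrow> V <+>\<^bsub>M\<^esub> V' \<subseteq> W"
  using submoduleE(5)[of W] by (fastforce simp: set_add_iff)

text \<open>
  An upper bound for the dimension of \<open>(U + V)/U\<close>. Subquotients of \<open>R\<close> are measured in this way
  inside \<open>R\<close>, so that neither quotient spaces nor bases are formed.
\<close>

definition dim_le :: "'c set \<Rightarrow> nat \<Rightarrow> 'c set \<Rightarrow> bool"
  where "dim_le U k V \<longleftrightarrow> (\<exists>xs. length xs = k \<and> set xs \<subseteq> carrier M \<and> V \<subseteq> adjoin U xs)"

text \<open>
  This is the dimension of \<open>(U + V)/U\<close> if that is finite, and a meaningless value otherwise.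
\<close>

definition rel_dim :: "'c set \<Rightarrow> 'c set \<Rightarrow> nat"
  where "rel_dim U V = (LEAST k. dim_le U k V)"

lemma dim_leI: "set xs \<subseteq> carrier M \<Longrightarrow> V \<subseteq> adjoin U xs \<Longrightarrow> dim_le U (length xs) V"
  by (auto simp: dim_le_def)

lemma dim_le_subset: "dim_le U k V \<Longrightarrow> V' \<subseteq> V \<Longrightarrow> dim_le U k V'"
  by (auto simp: dim_le_def)

lemma dim_le_base_mono: "dim_le U k V \<Longrightarrow> U \<subseteq> U' \<Longrightarrow> dim_le U' k V"
  using adjoin_mono unfolding dim_le_def by blast

lemma dim_le_refl: "dim_le U 0 U"
  by (auto simp: dim_le_def)

lemma rel_dim_le: "dim_le U k V \<Longrightarrow> rel_dim U V \<le> k"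
  unfolding rel_dim_def by (rule Least_le)

lemma dim_le_rel_dim: "dim_le U k V \<Longrightarrow> dim_le U (rel_dim U V) V"
  unfolding rel_dim_def by (rule LeastI)

lemma dim_le_add:
  assumes U: "submodule U K M" and V: "dim_le U k V" and W: "dim_le U l W"
  shows "dim_le U (k + l) (V <+>\<^bsub>M\<^esub> W)"
proof -
  obtain xs ys where xs: "length xs = k" "set xs \<subseteq> carrier M" "V \<subseteq> adjoin U xs"
    and ys: "length ys = l" "set ys \<subseteq> carrier M" "W \<subseteq> adjoin U ys"
    using V W by (auto simp: dim_le_def)
  have "V <+>\<^bsub>M\<^esub> W \<subseteq> adjoin U (xs @ ys)"
    using adjoin_add[OF U adjoin_subspace[OF U ys(2)] adjoin_base[OF U ys(2)] xs(2)] xs(3) ys(3)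
    by (fastforce simp: adjoin_append set_add_iff)
  then show ?thesis
    using xs ys by (auto simp: dim_le_def intro!: exI[of _ "xs @ ys"])
qed

definition linear_map :: "('c \<Rightarrow> 'c) \<Rightarrow> bool"
  where "linear_map f \<longleftrightarrow> f \<in> carrier M \<rightarrow> carrier M \<and>
    (\<forall>x\<in>carrier M. \<forall>y\<in>carrier M. f (x \<oplus> y) = f x \<oplus> f y) \<and>
    (\<forall>a\<in>carrier K. \<forall>x\<in>carrier M. f (a \<odot> x) = a \<odot> f x)"

lemma linear_mapD:
  assumes "linear_map f"
  shows "x \<in> carrier M \<Longrightarrow> f x \<in> carrier M"
    and "x \<in> carrier M \<Longrightarrow> y \<in> carrier M \<Longrightarrow> f (x \<oplus> y) = f x \<oplus> f y"
    and "a \<in> carrier K \<Longrightarrow> x \<in> carrier M \<Longrightarrow> f (a \<odot> x) = a \<odot> f x"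
  using assms by (auto simp: linear_map_def)

lemma linear_minus:
  assumes "linear_map f" "x \<in> carrier M"
  shows "f (\<ominus> x) = \<ominus> f x"
  using linear_mapD(3)[OF assms(1), of "\<ominus>\<^bsub>K\<^esub> \<one>\<^bsub>K\<^esub>" x] assms
  by (simp add: smult_l_minus linear_mapD)

lemma linear_diff:
  assumes "linear_map f" "x \<in> carrier M" "y \<in> carrier M"
  shows "f (x \<ominus> y) = f x \<ominus> f y"
  using assms by (simp add: a_minus_def linear_mapD linear_minus)

lemma linear_zero: "linear_map f \<Longrightarrow> f \<zero> = \<zero>"
  using linear_mapD(3)[of f "\<zero>\<^bsub>K\<^esub>" "\<zero>"] by (simp add: linear_mapD smult_l_null)

lemma preimage_subspace:
  assumes "linear_map f" "submodule V K M" "submodule E K M"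
  shows "submodule {v \<in> V. f v \<in> E} K M"
  by (rule submoduleI)
    (use assms in \<open>auto simp: submoduleE subspace_zero subspace_carrier linear_zero linear_minus linear_mapD\<close>)

lemma image_subspace:
  assumes f: "linear_map f" and V: "submodule V K M"
  shows "submodule (f ` V) K M"
proof (rule submoduleI)
  note c = subspace_carrier[OF V]
  show "f ` V \<subseteq> carrier M"
    using c linear_mapD(1)[OF f] by auto
  show "\<zero> \<in> f ` V"
    using linear_zero[OF f] subspace_zero[OF V] by force
  show "\<ominus> x \<in> f ` V" if "x \<in> f ` V" for x
    using that submoduleE(3)[OF V] c by (auto simp: linear_minus[OF f, symmetric])
  show "x \<oplus> y \<in> f ` V" if "x \<in> f ` V" "y \<in> f ` V" for x y
    using that submoduleE(5)[OF V] c by (auto simp: linear_mapD(2)[OF f, symmetric])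
  show "a \<odot> x \<in> f ` V" if "a \<in> carrier K" "x \<in> f ` V" for a x
    using that submoduleE(4)[OF V] c by (auto simp: linear_mapD(3)[OF f, symmetric])
qed

text \<open>
  Modulo \<open>E\<close>, the image of \<open>W\<close> is at most a line, and \<open>f w\<close> is a nonzero vector on it. Subtracting
  a multiple of \<open>w\<close> therefore moves any \<open>u \<in> W\<close> into the preimage of \<open>E\<close>.
\<close>

lemma subspace_line_split_at:
  assumes f: "linear_map f" and W: "submodule W K M" and E: "submodule E K M" and x: "x \<in> carrier M"
    and sub: "f ` W \<subseteq> line_extension E x" and w: "w \<in> W" "f w \<notin> E"
  shows "W \<subseteq> line_extension {u \<in> W. f u \<in> E} w"
proof
  fix u assume u: "u \<in> W"
  note cW = subspace_carrier[OF W] and cE = subspace_carrier[OF E]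
  obtain e0 a0 where 0: "e0 \<in> E" "a0 \<in> carrier K" "f w = e0 \<oplus> a0 \<odot> x"
    using sub w by (auto simp: line_extension_def)
  obtain e a where 1: "e \<in> E" "a \<in> carrier K" "f u = e \<oplus> a \<odot> x"
    using sub u by (auto simp: line_extension_def)
  have "a0 \<noteq> \<zero>\<^bsub>K\<^esub>"
    using 0 w x cE by auto
  then have unit: "a0 \<in> Units K"
    using 0 K.field_Units by auto
  define b where "b = a \<otimes>\<^bsub>K\<^esub> inv\<^bsub>K\<^esub> a0"
  have b: "b \<in> carrier K" "b \<otimes>\<^bsub>K\<^esub> a0 = a"
    using unit 1 0 by (auto simp: b_def K.m_assoc)
  have cc: "u \<in> carrier M" "w \<in> carrier M" "e \<in> carrier M" "e0 \<in> carrier M"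
    using u w 0 1 cW cE by auto
  have "b \<odot> f w = b \<odot> e0 \<oplus> a \<odot> x"
    unfolding 0(3) using 0 b x cc by (simp add: smult_r_distr smult_assoc1[symmetric])
  then have "f (u \<ominus> b \<odot> w) = (e \<oplus> a \<odot> x) \<ominus> (b \<odot> e0 \<oplus> a \<odot> x)"
    using f b cc 1(3) by (simp add: linear_diff linear_mapD)
  also have "\<dots> = e \<ominus> b \<odot> e0"
    using cc b x 1(2) 
    by (simp add: a_minus_def M.minus_add M.a_assoc M.a_comm M.a_lcomm M.r_neg1 M.r_neg2)
  finally have "f (u \<ominus> b \<odot> w) \<in> E"
    using subspace_diff[OF E] submoduleE(4)[OF E] 0 1 b by simp
  moreover have "u \<ominus> b \<odot> w \<in> W"
    using subspace_diff[OF W] submoduleE(4)[OF W] u w b by simp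
  moreover have "u = (u \<ominus> b \<odot> w) \<oplus> b \<odot> w"
    using cc b by (simp add: a_minus_def M.a_assoc M.l_neg)
  ultimately show "u \<in> line_extension {u \<in> W. f u \<in> E} w"
    using b by (intro line_extension_memI[of "u \<ominus> b \<odot> w" _ b]) auto
qed

lemma subspace_line_split:
  assumes f: "linear_map f" and W: "submodule W K M" and E: "submodule E K M" and x: "x \<in> carrier M"
    and sub: "f ` W \<subseteq> line_extension E x"
  obtains w where "w \<in> W" "W \<subseteq> line_extension {u \<in> W. f u \<in> E} w"
proof (cases "\<forall>w\<in>W. f w \<in> E")
  case True
  then have "{u \<in> W. f u \<in> E} = W" by auto
  then show ?thesis
    using that[of "\<zero>"] subspace_zero[OF W] line_extension_base[OF W M.zero_closed] by simp
next
  case False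
  then show ?thesis
    using subspace_line_split_at[OF assms] that by blast
qed

text \<open>
  The map induced by \<open>f\<close> on \<open>V\<close> modulo the preimage of \<open>E\<close> is injective, so its image is at least
  as large as its domain. In terms of spanning lists: removing one vector from the list spanning the
  image removes at most one dimension from \<open>V\<close>.
\<close>

lemma dim_le_preimage:
  assumes f: "linear_map f" and E: "submodule E K M"
    and V: "submodule V K M" and le: "dim_le E k (f ` V)"
  shows "dim_le {v \<in> V. f v \<in> E} k V"
proof -
  obtain xs where xs: "length xs = k" "set xs \<subseteq> carrier M" "f ` V \<subseteq> adjoin E xs"
    using le by (auto simp: dim_le_def)
  from xs(2,3) V have "dim_le {v \<in> V. f v \<in> E} (length xs) V"
  proof (induction xs arbitrary: V)
    case Nil
    then have "{v \<in> V. f v \<in> E} = V" by auto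
    then show ?case by (simp add: dim_le_refl)
  next
    case (Cons x xs)
    define V' where "V' = {v \<in> V. f v \<in> adjoin E xs}"
    have A: "submodule (adjoin E xs) K M"
      using Cons.prems E by (simp add: adjoin_subspace)
    have V': "submodule V' K M"
      unfolding V'_def using f Cons.prems A by (simp add: preimage_subspace)
    have "{v \<in> V'. f v \<in> E} = {v \<in> V. f v \<in> E}"
      using adjoin_base[OF E, of xs] Cons.prems by (auto simp: V'_def)
    moreover have "f ` V' \<subseteq> adjoin E xs"
      by (auto simp: V'_def)
    ultimately have "dim_le {v \<in> V. f v \<in> E} (length xs) V'"
      using Cons.IH[OF _ _ V'] Cons.prems by simp
    then obtain ys where ys: "length ys = length xs" "set ys \<subseteq> carrier M"
      "V' \<subseteq> adjoin {v \<in> V. f v \<in> E} ys"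
      by (auto simp: dim_le_def)
    obtain w where w: "w \<in> V" "V \<subseteq> line_extension V' w"
      using subspace_line_split[OF f Cons.prems(3) A, of x] Cons.prems by (auto simp: V'_def)
    have "V \<subseteq> adjoin {v \<in> V. f v \<in> E} (w # ys)"
      using w line_extension_mono[OF ys(3), of w] by auto
    moreover have "set (w # ys) \<subseteq> carrier M"
      using ys w subspace_carrier[OF Cons.prems(3)] by auto
    ultimately have "dim_le {v \<in> V. f v \<in> E} (length (w # ys)) V"
      by (intro dim_leI)
    then show ?case using ys by simp
  qed
  then show ?thesis using xs by simp
qed

lemma dim_le_image:
  assumes f: "linear_map f" and U: "submodule U K M" and fU: "f ` U \<subseteq> U'" and le: "dim_le U k V"
  shows "dim_le U' k (f ` V)"
proof -
  obtain xs where xs: "length xs = k" "set xs \<subseteq> carrier M" "V \<subseteq> adjoin U xs"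
    using le by (auto simp: dim_le_def)
  have "f ` adjoin U xs \<subseteq> adjoin U' (map f xs)"
    using xs(2)
  proof (induction xs)
    case Nil
    then show ?case using fU by simp
  next
    case (Cons x xs)
    show ?case
    proof
      fix y assume "y \<in> f ` adjoin U (x # xs)"
      then obtain u a where u: "u \<in> adjoin U xs" "a \<in> carrier K" "y = f (u \<oplus> a \<odot> x)"
        by (auto simp: line_extension_def)
      have "u \<in> carrier M"
        using u Cons.prems adjoin_subspace[OF U, of xs] subspace_carrier by auto
      then have "y = f u \<oplus> a \<odot> f x"
        using u Cons.prems by (simp add: linear_mapD[OF f])
      then show "y \<in> adjoin U' (map f (x # xs))"
        using u Cons by (auto intro: line_extension_memI)
    qed
  qed
  then show ?thesis
    using xs linear_mapD(1)[OF f] unfolding dim_le_def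
    by (intro exI[of _ "map f xs"]) auto
qed

lemma linear_id: "linear_map (\<lambda>x. x)"
  by (auto simp: linear_map_def)

text \<open>
  Dimension is additive along \<open>U \<subseteq> V \<subseteq> W\<close>; this direction turns lower bounds for the two steps
  into a lower bound for the whole. The proof cuts \<open>V\<close> and \<open>W\<close> with the span \<open>E\<close> of all but one of
  the vectors. The dimension that this cut loses is charged to \<open>V\<close> over \<open>U\<close> if \<open>V\<close> is not contained
  in \<open>E\<close>, and to \<open>W\<close> over \<open>V\<close> otherwise.
\<close>

lemma dim_le_split:
  assumes U: "submodule U K M"
  shows "\<lbrakk>submodule V K M; submodule W K M; U \<subseteq> V; V \<subseteq> W; dim_le U k W\<rbrakk> \<Longrightarrow>
    \<exists>i j. i + j = k \<and> dim_le U i V \<and> dim_le V j W"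
proof (induction k arbitrary: V W)
  case 0
  then have "W \<subseteq> U" by (auto simp: dim_le_def)
  then have "V = U" "W = U" using 0 by auto
  then show ?case using dim_le_refl by auto
next
  case (Suc k)
  obtain x xs where xs: "length xs = k" "set xs \<subseteq> carrier M" "x \<in> carrier M"
      "W \<subseteq> line_extension (adjoin U xs) x"
    using Suc.prems(5) by (auto simp: dim_le_def length_Suc_conv)
  define E where "E = adjoin U xs"
  have E: "submodule E K M" "U \<subseteq> E"
    using xs U by (auto simp: E_def adjoin_subspace adjoin_base)
  have WE: "W \<subseteq> line_extension E x" and VE: "V \<subseteq> line_extension E x"
    using xs Suc.prems by (auto simp: E_def)
  have "dim_le U k (W \<inter> E)"
    using xs by (auto simp: dim_le_def E_def)
  then obtain i j where ij: "i + j = k" "dim_le U i (V \<inter> E)" "dim_le (V \<inter> E) j (W \<inter> E)"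
    using Suc.IH[of "V \<inter> E" "W \<inter> E"] Suc.prems E subspace_Int by blast
  obtain ys where ys: "length ys = j" "set ys \<subseteq> carrier M" "W \<inter> E \<subseteq> adjoin (V \<inter> E) ys"
    using ij by (auto simp: dim_le_def)
  have ysV: "W \<inter> E \<subseteq> adjoin V ys"
    using ys adjoin_mono[of "V \<inter> E" V ys] by auto
  show ?case
  proof (cases "V \<subseteq> E")
    case True
    obtain w where w: "w \<in> W" "W \<subseteq> line_extension {u \<in> W. u \<in> E} w"
      using subspace_line_split[OF linear_id Suc.prems(2) E(1) xs(3)] WE by auto
    have "W \<subseteq> adjoin V (w # ys)"
      using w line_extension_mono[OF ysV, of w] by (auto simp: Collect_conj_eq)
    moreover have "set (w # ys) \<subseteq> carrier M"
      using w ys subspace_carrier[OF Suc.prems(2)] by auto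
    ultimately have "dim_le V (length (w # ys)) W"
      by (intro dim_leI)
    moreover have "V \<inter> E = V" using True by auto
    ultimately show ?thesis
      using ij ys by (intro exI[of _ i] exI[of _ "Suc j"]) auto
  next
    case False
    then obtain v where v: "v \<in> V" "v \<notin> E" by auto
    then have vW: "v \<in> W" and vc: "v \<in> carrier M"
      using Suc.prems subspace_carrier by auto
    have "V \<subseteq> line_extension {u \<in> V. u \<in> E} v"
      using subspace_line_split_at[OF linear_id Suc.prems(1) E(1) xs(3) _ v] VE by auto
    moreover obtain zs where zs: "length zs = i" "set zs \<subseteq> carrier M" "V \<inter> E \<subseteq> adjoin U zs"
      using ij by (auto simp: dim_le_def)
    ultimately have "V \<subseteq> adjoin U (v # zs)"
      using line_extension_mono[OF zs(3), of v] by (auto simp: Collect_conj_eq)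
    then have "dim_le U (length (v # zs)) V"
      using vc zs by (intro dim_leI) auto
    moreover have "W \<subseteq> adjoin V ys"
    proof -
      have "W \<subseteq> line_extension {u \<in> W. u \<in> E} v"
        using subspace_line_split_at[OF linear_id Suc.prems(2) E(1) xs(3) _ vW v(2)] WE by auto
      also have "\<dots> \<subseteq> adjoin V ys"
      proof
        fix y assume "y \<in> line_extension {u \<in> W. u \<in> E} v"
        then obtain u a where "u \<in> W \<inter> E" "a \<in> carrier K" "y = u \<oplus> a \<odot> v"
          by (auto simp: line_extension_def)
        moreover have "submodule (adjoin V ys) K M"
          using Suc.prems ys by (simp add: adjoin_subspace)
        moreover have "v \<in> adjoin V ys"
          using v adjoin_base[OF Suc.prems(1) ys(2)] by auto
        ultimately show "y \<in> adjoin V ys"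
          using ysV submoduleE(4,5) by blast
      qed
      finally show ?thesis .
    qed
    then have "dim_le V j W"
      using ys by (auto simp: dim_le_def)
    ultimately show ?thesis
      using ij zs by (intro exI[of _ "Suc i"] exI[of _ j]) auto
  qed
qed

lemma fin_dim_subspace_dim_le:
  assumes "fin_dim_subspace K M V"
  shows "\<exists>k. dim_le {\<zero>} k V"
proof -
  obtain B where B: "finite B" "B \<subseteq> V" "\<And>v. v \<in> V \<Longrightarrow> \<exists>c \<in> B \<rightarrow> carrier K. v = (\<Oplus>b\<in>B. c b \<odot> b)"
    and V: "submodule V K M"
    using assms unfolding fin_dim_subspace_def by blast
  have "B \<subseteq> carrier M"
    using B V subspace_carrier by blast
  with B(1) have "\<exists>xs. set xs \<subseteq> carrier M \<and> (\<forall>c \<in> B \<rightarrow> carrier K. (\<Oplus>b\<in>B. c b \<odot> b) \<in> adjoin {\<zero>} xs)"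
  proof (induction B rule: finite_induct)
    case empty
    show ?case by (intro exI[of _ "[]"]) auto
  next
    case (insert x B)
    then obtain xs where xs: "set xs \<subseteq> carrier M" 
      "\<And>c. c \<in> B \<rightarrow> carrier K \<Longrightarrow> (\<Oplus>b\<in>B. c b \<odot> b) \<in> adjoin {\<zero>} xs"
      by auto
    have "(\<Oplus>b\<in>insert x B. c b \<odot> b) \<in> adjoin {\<zero>} (x # xs)" if c: "c \<in> insert x B \<rightarrow> carrier K" for c
    proof -
      have in_c: "c b \<odot> b \<in> carrier M" if "b \<in> insert x B" for b
        using insert.prems c that by (intro smult_closed) (auto simp: Pi_def)
      have "(\<Oplus>b\<in>insert x B. c b \<odot> b) = c x \<odot> x \<oplus> (\<Oplus>b\<in>B. c b \<odot> b)"
        using insert in_c by (intro M.finsum_insert) auto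
      also have "\<dots> = (\<Oplus>b\<in>B. c b \<odot> b) \<oplus> c x \<odot> x"
        using in_c by (intro M.a_comm M.finsum_closed) auto
      finally show ?thesis
        using xs(2)[of c] c by (auto intro: line_extension_memI)
    qed
    then show ?case
      using xs insert.prems by (intro exI[of _ "x # xs"]) auto
  qed
  then obtain xs where xs: "set xs \<subseteq> carrier M"
    "\<forall>c \<in> B \<rightarrow> carrier K. (\<Oplus>b\<in>B. c b \<odot> b) \<in> adjoin {\<zero>} xs"
    by blast
  then have "V \<subseteq> adjoin {\<zero>} xs"
    using B(3) by blast
  then show ?thesis
    using xs(1) dim_leI by blast
qed

end

section \<open>Symbols and left ideals of the associated graded ring\<close>

sublocale assoc_algebra < module_over_field K R
  by unfold_locales

lemma (in assoc_algebra) right_mult_linear: "x \<in> carrier R \<Longrightarrow> linear_map (\<lambda>a. a \<otimes>\<^bsub>R\<^esub> x)"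
  by (auto simp: linear_map_def l_distr smult_mult_left)

lemma (in assoc_algebra) left_mult_linear: "x \<in> carrier R \<Longrightarrow> linear_map (\<lambda>a. x \<otimes>\<^bsub>R\<^esub> a)"
  by (auto simp: linear_map_def r_distr smult_mult_right)

lemma (in assoc_algebra) ideal_subspace:
  assumes "ideal J R"
  shows "submodule J K R"
proof -
  interpret J: ideal J R by fact
  show ?thesis
  proof (rule submoduleI)
    show "a \<odot>\<^bsub>R\<^esub> x \<in> J" if "a \<in> carrier K" "x \<in> J" for a x
    proof -
      have "a \<odot>\<^bsub>R\<^esub> x = (a \<odot>\<^bsub>R\<^esub> \<one>\<^bsub>R\<^esub>) \<otimes>\<^bsub>R\<^esub> x"
        using that by (simp add: smult_mult_left)
      then show ?thesis
        using that by (simp add: J.I_l_closed)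
    qed
  qed (use J.a_subset in auto)
qed

sublocale nat_filtration < RF: ring_filtration R \<Gamma>
  by (rule ring_filtration)

locale filtered_algebra = nat_filtration K R \<Gamma>
  for K :: "('k, 'c) ring_scheme" and R :: "('k, 'a, 'b) module_scheme" (structure) and \<Gamma>
begin

abbreviation pred :: "nat \<Rightarrow> 'a set"
  where "pred n \<equiv> filt_pred R \<Gamma> n"

lemma pred_subspace: "submodule (pred n) K R"
  using subspace_trivial subspace by (cases n) (auto simp: filt_pred_def)

lemma filt_zero: "\<zero> \<in> \<Gamma> n"
  using subspace by (rule subspace_zero)

text \<open>
  For a list of pairs \<open>(m, x)\<close> of a degree and an element this is
  \<open>U + \<Sum> \<Gamma>\<^bsub>n-m\<^esub> x\<close>. The case distinction gives \<open>\<Gamma>\<^bsub>n-m\<^esub>\<close> the value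
  \<open>0\<close> for \<open>m > n\<close>, where truncated subtraction would give \<open>\<Gamma>\<^sub>0\<close>.
  With \<open>U = \<Gamma>\<^bsub>n-1\<^esub>\<close> it describes degree \<open>n\<close> of the left ideal of the associated graded ring
  generated by symbols; with \<open>U = 0\<close>, a filtered piece of a left ideal of \<open>R\<close>; with all degrees
  \<open>0\<close>, the combinations modulo \<open>U\<close> of the given elements with coefficients in \<open>\<Gamma>\<^sub>n\<close>.
\<close>

primrec filt_span :: "'a set \<Rightarrow> (nat \<times> 'a) list \<Rightarrow> nat \<Rightarrow> 'a set"
  where
    "filt_span U [] n = U"
  | "filt_span U (p # S) n = (if fst p \<le> n
       then filt_span U S n <+>\<^bsub>R\<^esub> (\<lambda>a. a \<otimes> snd p) ` \<Gamma> (n - fst p) else filt_span U S n)"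

lemma filt_span_subspace:
  "submodule U K R \<Longrightarrow> snd ` set S \<subseteq> carrier R \<Longrightarrow> submodule (filt_span U S n) K R"
  by (induction S) (auto intro!: set_add_subspace image_subspace right_mult_linear subspace)

lemma filt_span_Cons:
  "submodule U K R \<Longrightarrow> snd ` set (p # S) \<subseteq> carrier R \<Longrightarrow> filt_span U S n \<subseteq> filt_span U (p # S) n"
  using set_add_left[OF filt_span_subspace image_subspace[OF right_mult_linear subspace]] by auto

lemma filt_span_base:
  "submodule U K R \<Longrightarrow> snd ` set S \<subseteq> carrier R \<Longrightarrow> U \<subseteq> filt_span U S n"
proof (induction S)
  case (Cons p S)
  then show ?case using filt_span_Cons[OF Cons.prems, of n] by auto
qed simp

lemma filt_span_head:
  assumes "submodule U K R" "snd ` set S \<subseteq> carrier R" "x \<in> carrier R"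
  shows "x \<in> filt_span U ((m, x) # S) m"
proof -
  have "(\<lambda>a. a \<otimes> x) ` \<Gamma> 0 \<subseteq> filt_span U ((m, x) # S) m"
    using set_add_right[OF filt_span_subspace[OF assms(1,2)] image_subspace[OF right_mult_linear[OF assms(3)] subspace]]
    by simp
  then show ?thesis
    using one_mem assms(3) by force
qed

text \<open>
  Multiplicativity of the filtration, \<open>\<Gamma>\<^sub>i \<Gamma>\<^bsub>n-m\<^esub> \<subseteq> \<Gamma>\<^bsub>i+n-m\<^esub>\<close>. The base may
  change because the main instance multiplies \<open>\<Gamma>\<^bsub>n-1\<^esub>\<close> into \<open>\<Gamma>\<^bsub>i+n-1\<^esub>\<close>.
\<close>

lemma filt_span_mult:
  assumes y: "y \<in> \<Gamma> i" and U: "submodule U K R" "submodule U' K R"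
    and UU: "\<And>u. u \<in> U \<Longrightarrow> y \<otimes> u \<in> U'"
  shows "snd ` set S \<subseteq> carrier R \<Longrightarrow> w \<in> filt_span U S n \<Longrightarrow> y \<otimes> w \<in> filt_span U' S (i + n)"
proof (induction S arbitrary: w)
  case Nil
  then show ?case using UU by simp
next
  case (Cons p S)
  show ?case
  proof (cases "fst p \<le> n")
    case True
    then obtain u a where u: "u \<in> filt_span U S n" "a \<in> \<Gamma> (n - fst p)" "w = u \<oplus> a \<otimes> snd p"
      using Cons.prems by (auto simp: set_add_iff)
    have c: "u \<in> carrier R" "a \<in> carrier R" "y \<in> carrier R" "snd p \<in> carrier R"
      using u y Cons.prems RF.filt_mem_carrier subspace_carrier[OF filt_span_subspace[OF U(1)]] by auto
    have "y \<otimes> a \<in> \<Gamma> (i + n - fst p)"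
      using mult_mem[OF y u(2)] True by simp
    moreover have "y \<otimes> w = y \<otimes> u \<oplus> (y \<otimes> a) \<otimes> snd p"
      using u c by (simp add: r_distr m_assoc)
    ultimately show ?thesis
      using True Cons.IH[OF _ u(1)] Cons.prems by (auto simp: set_add_iff)
  next
    case False
    then have "y \<otimes> w \<in> filt_span U' S (i + n)"
      using Cons by simp
    then show ?thesis
      using filt_span_Cons[OF U(2) Cons.prems(1)] by blast
  qed
qed

lemma filt_span_mono:
  assumes "submodule U K R" "submodule U' K R" "U \<subseteq> U'" "snd ` set S \<subseteq> carrier R" "n \<le> m"
  shows "filt_span U S n \<subseteq> filt_span U' S m"
proof
  fix w assume w: "w \<in> filt_span U S n"
  have "\<one> \<in> \<Gamma> (m - n)"
    using one_mem RF.filt_mono[of 0 "m - n"] by auto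
  moreover have "\<one> \<otimes> u \<in> U'" if "u \<in> U" for u
    using that assms(1,3) subspace_carrier by auto
  ultimately have "\<one> \<otimes> w \<in> filt_span U' S (m - n + n)"
    using assms w by (intro filt_span_mult)
  then show "w \<in> filt_span U' S m"
    using assms w subspace_carrier[OF filt_span_subspace[OF assms(1,4)]] by simp
qed

lemma filt_span_least:
  assumes "ideal J R" "U \<subseteq> J" "snd ` set S \<subseteq> J"
  shows "filt_span U S n \<subseteq> J"
  using assms(3)
proof (induction S)
  case (Cons p S)
  have "(\<lambda>a. a \<otimes> snd p) ` \<Gamma> (n - fst p) \<subseteq> J"
    using ideal.I_l_closed[OF assms(1)] Cons.prems RF.filt_mem_carrier by auto
  then show ?case
    using Cons set_add_least[OF _ _ ideal_subspace[OF assms(1)]] by auto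
qed (use assms in auto)

lemma filt_span_decompose:
  assumes "submodule U K R" "snd ` set S \<subseteq> carrier R"
  shows "filt_span U S n \<subseteq> U <+>\<^bsub>R\<^esub> filt_span {\<zero>} S n"
  using assms(2)
proof (induction S)
  case Nil
  then show ?case using subspace_carrier[OF assms(1)] by (auto simp: set_add_iff)
next
  case (Cons p S)
  have S: "submodule (filt_span {\<zero>} (p # S) n) K R"
    using filt_span_subspace[OF subspace_trivial Cons.prems] .
  define T where "T = filt_span {\<zero>} (p # S) n"
  have sum: "submodule (U <+>\<^bsub>R\<^esub> T) K R" and TU: "T \<subseteq> U <+>\<^bsub>R\<^esub> T"
    using set_add_subspace[OF assms(1) S] set_add_right[OF assms(1) S] by (simp_all add: T_def)
  have "filt_span {\<zero>} S n \<subseteq> T"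
    unfolding T_def using subspace_trivial Cons.prems by (rule filt_span_Cons)
  then have "U <+>\<^bsub>R\<^esub> filt_span {\<zero>} S n \<subseteq> U <+>\<^bsub>R\<^esub> T"
    unfolding set_add_def' by blast
  then have tail: "filt_span U S n \<subseteq> U <+>\<^bsub>R\<^esub> T"
    using Cons by auto
  show ?case
  proof (cases "fst p \<le> n")
    case True
    have "(\<lambda>a. a \<otimes> snd p) ` \<Gamma> (n - fst p) \<subseteq> T"
      using set_add_right[OF filt_span_subspace[OF subspace_trivial]
        image_subspace[OF right_mult_linear subspace]] True Cons.prems by (simp add: T_def)
    then show ?thesis
      using True set_add_least[OF tail _ sum] TU by (simp add: T_def)
  next
    case False
    then show ?thesis
      using tail by (simp add: T_def)
  qed
qed

text \<open>
  Subadditivity of dimension over the summands, where \<open>d m\<close> bounds the dimension of the summand of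
  an entry of degree \<open>m\<close>.
\<close>

lemma filt_span_dim:
  assumes Z: "submodule Z K R" and U: "dim_le Z k U"
  shows "(\<And>p. p \<in> set S \<Longrightarrow> fst p \<le> n \<Longrightarrow> dim_le Z (d (fst p)) ((\<lambda>a. a \<otimes> snd p) ` \<Gamma> (n - fst p)))
    \<Longrightarrow> dim_le Z (k + (\<Sum>p\<leftarrow>S. if fst p \<le> n then d (fst p) else 0)) (filt_span U S n)"
proof (induction S)
  case (Cons p S)
  then have IH: "dim_le Z (k + (\<Sum>p\<leftarrow>S. if fst p \<le> n then d (fst p) else 0)) (filt_span U S n)"
    by simp
  show ?case
    using dim_le_add[OF Z IH, of "d (fst p)"] Cons.prems[of p] IH by (auto simp: algebra_simps)
qed (use U in simp)

text \<open>
  If \<open>x \<in> \<Gamma>\<^sub>m\<close> for all entries \<open>(m, x)\<close> of \<open>S\<close>, this is the left ideal generated by the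
  symbols \<open>x + \<Gamma>\<^bsub>m-1\<^esub>\<close>. A coset of \<open>\<Gamma>\<^bsub>n-1\<^esub>\<close> is tested for membership in a subspace
  modulo \<open>\<Gamma>\<^bsub>n-1\<^esub>\<close> by inclusion of sets, so that representatives need not be chosen.
\<close>

definition symbol_left_ideal :: "(nat \<times> 'a) list \<Rightarrow> (nat \<Rightarrow> 'a set) set"
  where "symbol_left_ideal S =
    {f \<in> carrier (assoc_graded R \<Gamma>). \<forall>n. f n \<subseteq> filt_span (pred n) S n}"

lemma finsum_cosets_subset:
  assumes W: "submodule W K R" "pred n \<subseteq> W" and "finite A"
  shows "(\<And>i. i \<in> A \<Longrightarrow> c i \<in> carrier (subquotient R (\<Gamma> n) (pred n)) \<and> c i \<subseteq> W) \<Longrightarrow>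
    (\<Oplus>\<^bsub>subquotient R (\<Gamma> n) (pred n)\<^esub>i\<in>A. c i) \<subseteq> W"
  using \<open>finite A\<close>
proof (induction A rule: finite_induct)
  case empty
  interpret C: abelian_group "subquotient R (\<Gamma> n) (pred n)" by (rule RF.comp_group)
  show ?case using W by (simp add: subquotient_simps)
next
  case (insert x A)
  interpret C: abelian_group "subquotient R (\<Gamma> n) (pred n)" by (rule RF.comp_group)
  have "(\<Oplus>\<^bsub>subquotient R (\<Gamma> n) (pred n)\<^esub>i\<in>insert x A. c i)
      = c x \<oplus>\<^bsub>subquotient R (\<Gamma> n) (pred n)\<^esub> (\<Oplus>\<^bsub>subquotient R (\<Gamma> n) (pred n)\<^esub>i\<in>A. c i)"
    using insert by (intro C.finsum_insert) auto
  then show ?case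
    using insert set_add_least[OF _ _ W(1)] by (simp add: subquotient_simps)
qed

lemma mem_coset: "y \<in> pred n +> x \<longleftrightarrow> (\<exists>u\<in>pred n. y = u \<oplus> x)"
  by (auto simp: a_r_coset_def')

lemma coset_subset:
  assumes "submodule W K R" "pred n \<subseteq> W" "x \<in> W"
  shows "pred n +> x \<subseteq> W"
  using assms by (auto simp: mem_coset intro!: submoduleE(5)[OF assms(1)])

lemma self_mem_coset: "x \<in> carrier R \<Longrightarrow> x \<in> pred n +> x"
  using subspace_zero[OF pred_subspace] by (force simp: mem_coset)

lemma graded_component:
  assumes "f \<in> carrier (assoc_graded R \<Gamma>)"
  obtains x where "x \<in> \<Gamma> n" "f n = pred n +> x"
  using assms by (auto simp: assoc_graded_def subquotient_simps)

lemma symbol_left_ideal: 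
  assumes S: "snd ` set S \<subseteq> carrier R"
  shows "left_ideal (symbol_left_ideal S) (assoc_graded R \<Gamma>)"
proof -
  interpret G: ring "assoc_graded R \<Gamma>" by (rule RF.assoc_graded_ring)
  note sub = filt_span_subspace[OF pred_subspace S] filt_span_base[OF pred_subspace S]
  have mult: "a \<otimes>\<^bsub>assoc_graded R \<Gamma>\<^esub> f \<in> symbol_left_ideal S"
    if a: "a \<in> carrier (assoc_graded R \<Gamma>)" and f: "f \<in> symbol_left_ideal S" for a f
  proof -
    have fG: "f \<in> carrier (assoc_graded R \<Gamma>)"
      using f by (simp add: symbol_left_ideal_def)
    have "(a \<otimes>\<^bsub>assoc_graded R \<Gamma>\<^esub> f) n \<subseteq> filt_span (pred n) S n" for n
    proof -
      have "rcoset_mult R (pred n) (a i) (f (n - i)) \<in> carrier (subquotient R (\<Gamma> n) (pred n)) \<and>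
          rcoset_mult R (pred n) (a i) (f (n - i)) \<subseteq> filt_span (pred n) S n" if i: "i \<in> {..n}" for i
      proof -
        obtain x where x: "x \<in> \<Gamma> i" "a i = pred i +> x"
          by (rule graded_component[OF a])
        obtain y where y: "y \<in> \<Gamma> (n - i)" "f (n - i) = pred (n - i) +> y"
          by (rule graded_component[OF fG])
        have "y \<in> filt_span (pred (n - i)) S (n - i)"
          using f y self_mem_coset[OF RF.filt_mem_carrier[OF y(1)]]
          by (auto simp: symbol_left_ideal_def)
        moreover have "x \<otimes> u \<in> pred (i + (n - i))" if "u \<in> pred (n - i)" for u
          using RF.pred_mult_right[OF x(1) that] .
        ultimately have "x \<otimes> y \<in> filt_span (pred (i + (n - i))) S (i + (n - i))"
          by (intro filt_span_mult[OF x(1) pred_subspace pred_subspace _ S])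
        then have xy: "x \<otimes> y \<in> filt_span (pred n) S n" "x \<otimes> y \<in> \<Gamma> n"
          using i mult_mem[OF x(1) y(1)] by auto
        have "rcoset_mult R (pred n) (a i) (f (n - i)) = pred n +> x \<otimes> y"
          using RF.graded_mult_coset[OF x(1) y(1)] i x y by simp
        then show ?thesis
          using xy coset_subset[OF sub xy(1)] by (simp add: subquotient_simps)
      qed
      then show ?thesis
        using finsum_cosets_subset[OF sub finite_atMost] by (simp add: assoc_graded_def)
    qed
    then show ?thesis
      using G.m_closed[OF a fG] by (simp add: symbol_left_ideal_def)
  qed
  have "additive_subgroup (symbol_left_ideal S) (assoc_graded R \<Gamma>)"
  proof (intro additive_subgroup.intro G.add.subgroupI)
    show "symbol_left_ideal S \<subseteq> carrier (assoc_graded R \<Gamma>)"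
      by (auto simp: symbol_left_ideal_def)
    have "\<zero>\<^bsub>assoc_graded R \<Gamma>\<^esub> \<in> symbol_left_ideal S"
      using G.zero_closed sub(2) by (simp add: symbol_left_ideal_def) (simp add: assoc_graded_def)
    then show "symbol_left_ideal S \<noteq> {}"
      by auto
    show "f \<oplus>\<^bsub>assoc_graded R \<Gamma>\<^esub> g \<in> symbol_left_ideal S"
      if fg: "f \<in> symbol_left_ideal S" "g \<in> symbol_left_ideal S" for f g
    proof -
      have "(f \<oplus>\<^bsub>assoc_graded R \<Gamma>\<^esub> g) n = f n <+>\<^bsub>R\<^esub> g n" for n
        by (simp add: assoc_graded_def subquotient_simps)
      then show ?thesis
        using fg G.a_closed[of f g] set_add_least[OF _ _ sub(1)] by (simp add: symbol_left_ideal_def)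
    qed
    show "\<ominus>\<^bsub>assoc_graded R \<Gamma>\<^esub> f \<in> symbol_left_ideal S" if f: "f \<in> symbol_left_ideal S" for f
    proof -
      have "f \<in> carrier (assoc_graded R \<Gamma>)"
        using f by (simp add: symbol_left_ideal_def)
      then have "\<ominus>\<^bsub>assoc_graded R \<Gamma>\<^esub> f = (\<ominus>\<^bsub>assoc_graded R \<Gamma>\<^esub> \<one>\<^bsub>assoc_graded R \<Gamma>\<^esub>) \<otimes>\<^bsub>assoc_graded R \<Gamma>\<^esub> f"
        by (simp add: G.l_minus)
      then show ?thesis
        using mult[OF _ f] by simp
    qed
  qed
  then show ?thesis
    using mult by (simp add: left_ideal_def left_ideal_axioms_def G.ring_axioms)
qed

lemma symbol_left_ideal_Cons:
  assumes "snd ` set (p # S) \<subseteq> carrier R"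
  shows "symbol_left_ideal S \<subseteq> symbol_left_ideal (p # S)"
  using filt_span_Cons[OF pred_subspace assms] unfolding symbol_left_ideal_def by blast

text \<open>
  The symbol of \<open>x\<close> in degree \<open>m\<close> belongs to the larger left ideal by construction; its membership
  in the smaller one says that \<open>x\<close> is already accounted for by \<open>S\<close>.
\<close>

lemma symbol_left_ideal_stable:
  assumes S: "snd ` set S \<subseteq> carrier R" and x: "x \<in> \<Gamma> m"
    and eq: "symbol_left_ideal ((m, x) # S) = symbol_left_ideal S"
  shows "x \<in> filt_span (pred m) S m"
proof -
  have xc: "x \<in> carrier R"
    using x by (rule RF.filt_mem_carrier)
  have S': "snd ` set ((m, x) # S) \<subseteq> carrier R"
    using S xc by simp
  define \<sigma> where "\<sigma> = (\<lambda>n. pred n +> (if n = m then x else \<zero>))"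
  have "{n. \<sigma> n \<noteq> pred n} \<subseteq> {m}"
    by (auto simp: \<sigma>_def RF.coset_zero)
  then have "finite {n. \<sigma> n \<noteq> pred n}"
    by (rule finite_subset) simp
  then have "\<sigma> \<in> carrier (assoc_graded R \<Gamma>)"
    using x filt_zero by (auto simp: assoc_graded_def subquotient_simps \<sigma>_def)
  moreover have "(if n = m then x else \<zero>) \<in> filt_span (pred n) ((m, x) # S) n" for n
    using filt_span_head[OF pred_subspace S xc] subspace_zero[OF filt_span_subspace[OF pred_subspace S']]
    by (simp del: filt_span.simps)
  then have "\<sigma> n \<subseteq> filt_span (pred n) ((m, x) # S) n" for n
    unfolding \<sigma>_def
    by (intro coset_subset filt_span_subspace filt_span_base pred_subspace S')
  ultimately have "\<sigma> \<in> symbol_left_ideal ((m, x) # S)"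
    by (simp add: symbol_left_ideal_def)
  then have "\<sigma> m \<subseteq> filt_span (pred m) S m"
    unfolding eq by (simp add: symbol_left_ideal_def)
  then show ?thesis
    using self_mem_coset[OF xc] by (auto simp: \<sigma>_def)
qed

text \<open>
  The ascending chain condition for the left ideals generated by symbols. The predicate \<open>Q\<close>
  restricts which elements may be appended: those of a given ideal in one use, those of sufficiently
  sparse degree in the other.
\<close>

lemma noetherian_saturated_list:
  assumes noeth: "left_noetherian (assoc_graded R \<Gamma>)"
    and Nil: "Q []" and Q: "\<And>S m x. Q S \<Longrightarrow> (m, x) \<in> set S \<Longrightarrow> x \<in> \<Gamma> m"
  shows "\<exists>S. Q S \<and> (\<forall>m x. Q ((m, x) # S) \<longrightarrow> x \<in> filt_span (pred m) S m)"
proof (rule ccontr)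
  assume "\<not> ?thesis"
  then have "\<forall>S. \<exists>p. Q S \<longrightarrow> Q (p # S) \<and> snd p \<notin> filt_span (pred (fst p)) S (fst p)"
    by fastforce
  then obtain g where g: "\<And>S. Q S \<Longrightarrow> Q (g S # S)"
      "\<And>S. Q S \<Longrightarrow> snd (g S) \<notin> filt_span (pred (fst (g S))) S (fst (g S))"
    by metis
  \<comment> \<open>Appending a bad element at every step yields a chain of left ideals that never stabilizes.\<close>
  define T where "T = rec_nat [] (\<lambda>_ S. g S # S)"
  have T: "T 0 = []" "T (Suc k) = g (T k) # T k" for k
    by (auto simp: T_def)
  have QT: "Q (T k)" for k
    by (induction k) (auto simp: T Nil g)
  have c: "snd ` set (T k) \<subseteq> carrier R" for k
    using Q[OF QT] RF.filt_mem_carrier by fastforce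
  have "left_ideal (symbol_left_ideal (T k)) (assoc_graded R \<Gamma>)" for k
    using symbol_left_ideal[OF c] .
  moreover have "symbol_left_ideal (T k) \<subseteq> symbol_left_ideal (T (Suc k))" for k
    using symbol_left_ideal_Cons[of "g (T k)" "T k"] c[of "Suc k"] by (simp add: T)
  ultimately obtain m where m: "symbol_left_ideal (T n) = symbol_left_ideal (T m)" if "n \<ge> m" for n
    using noeth unfolding left_noetherian_def by meson
  have "snd (g (T m)) \<in> filt_span (pred (fst (g (T m)))) (T m) (fst (g (T m)))"
  proof (rule symbol_left_ideal_stable[OF c])
    show "snd (g (T m)) \<in> \<Gamma> (fst (g (T m)))"
      using Q[OF QT[of "Suc m"], of "fst (g (T m))" "snd (g (T m))"] by (simp add: T)
    show "symbol_left_ideal ((fst (g (T m)), snd (g (T m))) # T m) = symbol_left_ideal (T m)"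
      using m[of "Suc m"] by (simp add: T)
  qed
  then show False
    using g(2)[OF QT] by blast
qed

end


section \<open>Growth of filtrations with noetherian associated graded ring\<close>

text \<open>
  If from some degree on \<open>D n\<close> never exceeds \<open>D (n - 1) + \<Sum> D (n - m)\<close>, a bound \<open>C\<close> for
  \<open>D n q\<^sup>n\<close> in all smaller degrees passes on to \<open>n\<close>, because
  \<open>D n q\<^sup>n \<le> q C + \<Sum> q\<^sup>m C \<le> C\<close>. The last conclusion allows the choice to be
  repeated with \<open>n\<close> added to the list.
\<close>

lemma sparse_degree_exists:
  fixes D :: "nat \<Rightarrow> nat" and q :: real
  assumes q: "0 < q" "q < 1" and unbounded: "\<not> (\<exists>C. \<forall>n. real (D n) * q ^ n \<le> C)"
    and weight: "q + (\<Sum>m\<leftarrow>ms. q ^ m) < 1"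
  obtains n where "n > 0" "D n > D (n - 1) + (\<Sum>m\<leftarrow>ms. if m \<le> n then D (n - m) else 0)"
    "q + (q ^ n + (\<Sum>m\<leftarrow>ms. q ^ m)) < 1"
proof -
  have "\<exists>N. q ^ N < 1 - (q + (\<Sum>m\<leftarrow>ms. q ^ m))"
    using q weight by (intro real_arch_pow_inv) auto
  then obtain N where N: "q ^ N < 1 - (q + (\<Sum>m\<leftarrow>ms. q ^ m))" by blast
  have large: "q + (q ^ n + (\<Sum>m\<leftarrow>ms. q ^ m)) < 1" if "n \<ge> N" for n
  proof -
    have "q ^ n \<le> q ^ N"
      using that q by (intro power_decreasing) auto
    then show ?thesis using N by linarith
  qed
  \<comment> \<open>A degree \<open>0\<close> alone would have weight \<open>1\<close>; so the recursion refers to smaller degrees only.\<close>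
  have pos: "m > 0" if "m \<in> set ms" for m
  proof (rule ccontr)
    assume "\<not> m > 0"
    then have "1 \<in> set (map (\<lambda>m. q ^ m) ms)"
      using that by force
    then have "1 \<le> (\<Sum>m\<leftarrow>ms. q ^ m)"
      using q by (intro member_le_sum_list) auto
    then show False using weight q by simp
  qed
  have "\<exists>n\<ge>Suc N. D n > D (n - 1) + (\<Sum>m\<leftarrow>ms. if m \<le> n then D (n - m) else 0)"
  proof (rule ccontr)
    assume "\<not> ?thesis"
    then have le: "D n \<le> D (n - 1) + (\<Sum>m\<leftarrow>ms. if m \<le> n then D (n - m) else 0)"
      if "n \<ge> Suc N" for n
      using that by (meson not_less)
    \<comment> \<open>This bounds \<open>D n q\<^sup>n\<close> for \<open>n \<le> N\<close>, where the recursion is not available.\<close>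
    define C where "C = (\<Sum>n\<le>N. real (D n))"
    have C: "C \<ge> 0"
      by (simp add: C_def sum_nonneg)
    have "real (D n) * q ^ n \<le> C" for n
    proof (induction n rule: less_induct)
      case (less n)
      show ?case
      proof (cases "n \<le> N")
        case True
        then have "real (D n) \<le> C"
          unfolding C_def by (intro member_le_sum) auto
        moreover have "real (D n) * q ^ n \<le> real (D n) * 1"
          using q by (intro mult_left_mono power_le_one) auto
        ultimately show ?thesis by simp
      next
        case False
        then have n: "n \<ge> Suc N" "n > 0" by auto
        have first: "real (D (n - 1)) * q ^ n \<le> q * C"
        proof -
          have "q ^ n = q * q ^ (n - 1)"
            using n by (simp add: power_eq_if)
          then show ?thesis
            using less[of "n - 1"] n q by (simp add: mult.left_commute)
        qed
        have "(\<Sum>m\<leftarrow>ms. (if m \<le> n then real (D (n - m)) else 0) * q ^ n) \<le> (\<Sum>m\<leftarrow>ms. q ^ m * C)"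
        proof (rule sum_list_mono)
          fix m assume m: "m \<in> set ms"
          show "(if m \<le> n then real (D (n - m)) else 0) * q ^ n \<le> q ^ m * C"
          proof (cases "m \<le> n")
            case True
            then have "q ^ n = q ^ m * q ^ (n - m)"
              by (simp flip: power_add)
            moreover have "real (D (n - m)) * q ^ (n - m) \<le> C"
              using less[of "n - m"] pos[OF m] n by simp
            ultimately show ?thesis
              using True q by (simp add: mult.left_commute)
          qed (use C q in simp)
        qed
        also have "\<dots> = (\<Sum>m\<leftarrow>ms. q ^ m) * C"
          by (simp add: sum_list_mult_const)
        finally have rest: "(\<Sum>m\<leftarrow>ms. if m \<le> n then real (D (n - m)) else 0) * q ^ n \<le> (\<Sum>m\<leftarrow>ms. q ^ m) * C"
          by (simp add: sum_list_mult_const)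
        have "real (\<Sum>m\<leftarrow>ms. if m \<le> n then D (n - m) else 0)
            = (\<Sum>m\<leftarrow>ms. if m \<le> n then real (D (n - m)) else 0)"
          by (induction ms) auto
        then have "real (D n) \<le> real (D (n - 1)) + (\<Sum>m\<leftarrow>ms. if m \<le> n then real (D (n - m)) else 0)"
          using le[OF n(1)] by linarith
        then have "real (D n) * q ^ n
            \<le> (real (D (n - 1)) + (\<Sum>m\<leftarrow>ms. if m \<le> n then real (D (n - m)) else 0)) * q ^ n"
          using q by (intro mult_right_mono) auto
        also have "\<dots> \<le> (q + (\<Sum>m\<leftarrow>ms. q ^ m)) * C"
          using first rest by (simp add: distrib_right)
        also have "\<dots> \<le> 1 * C"
          using weight C by (intro mult_right_mono) auto
        finally show ?thesis by simp
      qed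
    qed
    then show False using unbounded by blast
  qed
  then obtain n where "n \<ge> Suc N" "D n > D (n - 1) + (\<Sum>m\<leftarrow>ms. if m \<le> n then D (n - m) else 0)"
    by blast
  then show ?thesis
    using large[of n] by (intro that[of n]) auto
qed

text \<open>
  Iterating the inequality gives \<open>f (k c) \<ge> (t/s)\<^sup>k\<close>, which is exponential growth of \<open>f\<close>.
\<close>

lemma no_shifted_ratio_of_subexponential_growth:
  fixes f D :: "nat \<Rightarrow> nat" and s t c :: nat
  assumes ratio: "\<And>n. t * f n \<le> s * f (n + c)" and "s < t" and "f 0 > 0" and fD: "\<And>n. f n \<le> D n"
    and sub: "\<And>q. 0 < q \<Longrightarrow> q < 1 \<Longrightarrow> \<exists>C. \<forall>n. real (D n) * q ^ n \<le> C"
  shows False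
proof -
  have s: "s > 0"
    using ratio[of 0] \<open>f 0 > 0\<close> \<open>s < t\<close> by (cases s) auto
  have c: "c > 0"
    using ratio[of 0] \<open>f 0 > 0\<close> \<open>s < t\<close> by (cases c) auto
  define r where "r = real t / real s"
  have r: "r > 1"
    using s \<open>s < t\<close> by (simp add: r_def)
  have step: "r * real (f n) \<le> real (f (n + c))" for n
  proof -
    have "real t * real (f n) \<le> real s * real (f (n + c))"
      using ratio[of n] by (simp flip: of_nat_mult)
    then show ?thesis
      using s by (simp add: r_def field_simps)
  qed
  have lower: "r ^ k \<le> real (f (k * c))" for k
  proof (induction k)
    case 0
    then show ?case using \<open>f 0 > 0\<close> by simp
  next
    case (Suc k)
    have "r ^ Suc k \<le> r * real (f (k * c))"
      using Suc r by simp
    also have "\<dots> \<le> real (f (Suc k * c))"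
      using step[of "k * c"] by (simp add: add.commute)
    finally show ?case .
  qed
  \<comment> \<open>The mean of \<open>1\<close> and \<open>s/t\<close> keeps \<open>q\<close> below \<open>1\<close> while \<open>(t/s) q\<^sup>c\<close> stays above \<open>1\<close>.\<close>
  define q where "q = root c ((1 + 1 / r) / 2)"
  have "0 < (1 + 1 / r) / 2" "(1 + 1 / r) / 2 < 1" "(1 + 1 / r) / 2 * r > 1"
    using r by (simp_all add: field_simps)
  then have q: "0 < q" "q < 1" "r * q ^ c > 1"
    using c by (simp_all add: q_def mult.commute)
  obtain C where C: "real (D n) * q ^ n \<le> C" for n
    using sub[OF q(1,2)] by blast
  have "(r * q ^ c) ^ k \<le> C" for k
  proof -
    have "(r * q ^ c) ^ k = r ^ k * q ^ (k * c)"
      by (simp add: power_mult_distrib mult.commute flip: power_mult)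
    also have "\<dots> \<le> real (D (k * c)) * q ^ (k * c)"
      using q lower[of k] fD[of "k * c"] by (intro mult_right_mono) auto
    also have "\<dots> \<le> C" by (rule C)
    finally show ?thesis .
  qed
  moreover obtain k where "C < (r * q ^ c) ^ k"
    using real_arch_pow[OF q(3)] by blast
  ultimately show False
    by (meson not_less)
qed

locale noetherian_filtration = filtered_algebra K R \<Gamma>
  for K :: "('k, 'c) ring_scheme" and R :: "('k, 'a, 'b) module_scheme" (structure) and \<Gamma> +
  assumes fin_dim: "fin_dim_subspace K R (\<Gamma> i)"
    and noetherian: "left_noetherian (assoc_graded R \<Gamma>)"
begin

lemma filt_dim_le: 
  assumes "submodule U K R"
  shows "dim_le U (rel_dim U (\<Gamma> n)) (\<Gamma> n)"
proof -
  obtain k where "dim_le {\<zero>} k (\<Gamma> n)"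
    using fin_dim_subspace_dim_le[OF fin_dim] by blast
  then have "dim_le U k (\<Gamma> n)"
    using subspace_zero[OF assms] by (elim dim_le_base_mono) auto
  then show ?thesis
    by (rule dim_le_rel_dim)
qed

lemma filt_dim_mono:
  assumes "submodule U K R"
  shows "rel_dim U (\<Gamma> n) \<le> rel_dim {\<zero>} (\<Gamma> n)"
  using dim_le_base_mono[OF filt_dim_le[OF subspace_trivial], of U n] subspace_zero[OF assms]
  by (intro rel_dim_le) auto

text \<open>
  Give degree \<open>m\<close> the weight \<open>q\<^sup>m\<close>, and take a list of elements with total weight below
  \<open>1 - q\<close> that is saturated among such lists. If the dimensions were not bounded by a multiple of
  \<open>q\<^bsup>-n\<^esup>\<close>, there would be a degree \<open>n\<close> whose weight still fits and in which the left ideal generated by the list is too small, for reasons of dimension, to be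
  everything; but saturation says that it is everything there.
\<close>

theorem filt_dim_subexponential:
  assumes q: "0 < q" "q < (1::real)"
  shows "\<exists>C. \<forall>n. real (rel_dim {\<zero>} (\<Gamma> n)) * q ^ n \<le> C"
proof (rule ccontr)
  assume unbounded: "\<not> ?thesis"
  define Q where "Q = (\<lambda>S. (\<forall>(m, x)\<in>set S. x \<in> \<Gamma> m) \<and> q + (\<Sum>m\<leftarrow>map fst S. q ^ m) < 1)"
  have "Q []"
    using q by (simp add: Q_def)
  moreover have "x \<in> \<Gamma> m" if "Q S" "(m, x) \<in> set S" for S m x
    using that by (auto simp: Q_def)
  ultimately have "\<exists>S. Q S \<and> (\<forall>m x. Q ((m, x) # S) \<longrightarrow> x \<in> filt_span (pred m) S m)"
    by (rule noetherian_saturated_list[OF noetherian])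
  then obtain S where S: "Q S" "\<And>m x. Q ((m, x) # S) \<Longrightarrow> x \<in> filt_span (pred m) S m"
    by blast
  have "q + (\<Sum>m\<leftarrow>map fst S. q ^ m) < 1"
    using S(1) by (simp add: Q_def)
  then obtain n where n: "n > 0" "rel_dim {\<zero>} (\<Gamma> n) > rel_dim {\<zero>} (\<Gamma> (n - 1))
        + (\<Sum>m\<leftarrow>map fst S. if m \<le> n then rel_dim {\<zero>} (\<Gamma> (n - m)) else 0)"
      "q + (q ^ n + (\<Sum>m\<leftarrow>map fst S. q ^ m)) < 1"
    by (rule sparse_degree_exists[OF q unbounded])
  have "dim_le {\<zero>} (rel_dim {\<zero>} (\<Gamma> (n - 1)) +
      (\<Sum>p\<leftarrow>S. if fst p \<le> n then rel_dim {\<zero>} (\<Gamma> (n - fst p)) else 0)) (filt_span (pred n) S n)"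
  proof (rule filt_span_dim[OF subspace_trivial])
    show "dim_le {\<zero>} (rel_dim {\<zero>} (\<Gamma> (n - 1))) (pred n)"
      using filt_dim_le[OF subspace_trivial, of "n - 1"] n(1) by (auto simp: filt_pred_def split: nat.split)
    show "dim_le {\<zero>} (rel_dim {\<zero>} (\<Gamma> (n - fst p))) ((\<lambda>a. a \<otimes> snd p) ` \<Gamma> (n - fst p))"
      if "p \<in> set S" for p
    proof -
      have "snd p \<in> carrier R"
        using that S(1) RF.filt_mem_carrier[of "snd p" "fst p"] by (auto simp: Q_def)
      then show ?thesis
        by (intro dim_le_image[OF right_mult_linear subspace_trivial _ filt_dim_le[OF subspace_trivial]])
          auto
    qed
  qed
  moreover have "\<Gamma> n \<subseteq> filt_span (pred n) S n"
  proof
    fix x assume "x \<in> \<Gamma> n"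
    then have "Q ((n, x) # S)"
      using S(1) n(3) by (simp add: Q_def)
    then show "x \<in> filt_span (pred n) S n"
      by (rule S(2))
  qed
  ultimately have "rel_dim {\<zero>} (\<Gamma> n) \<le> rel_dim {\<zero>} (\<Gamma> (n - 1)) +
      (\<Sum>p\<leftarrow>S. if fst p \<le> n then rel_dim {\<zero>} (\<Gamma> (n - fst p)) else 0)"
    by (rule rel_dim_le[OF dim_le_subset])
  then show False
    using n(2) by (simp add: comp_def)
qed

section \<open>Comparing the two ranks of a bimodule subquotient\<close>

text \<open>
  A saturated list of elements of \<open>J\<close> generates all symbols of \<open>J\<close>. An element of
  \<open>J \<inter> \<Gamma>\<^sub>n\<close> is thus a combination of the right degrees up to an error in
  \<open>\<Gamma>\<^bsub>n-1\<^esub>\<close>; the error lies in \<open>J\<close> again, and induction on \<open>n\<close> removes it.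
\<close>

lemma ideal_finitely_spanned:
  assumes J: "ideal J R"
  obtains S where "snd ` set S \<subseteq> J" "\<And>n. J \<inter> \<Gamma> n \<subseteq> filt_span {\<zero>} S n"
proof -
  note Js = ideal_subspace[OF J]
  define Q where "Q = (\<lambda>S. \<forall>(m, x)\<in>set S. x \<in> J \<inter> \<Gamma> m)"
  have "Q []"
    by (simp add: Q_def)
  moreover have "x \<in> \<Gamma> m" if "Q S" "(m, x) \<in> set S" for S m x
    using that by (auto simp: Q_def)
  ultimately have "\<exists>S. Q S \<and> (\<forall>m x. Q ((m, x) # S) \<longrightarrow> x \<in> filt_span (pred m) S m)"
    by (rule noetherian_saturated_list[OF noetherian])
  then obtain S where S: "Q S" "\<And>m x. Q ((m, x) # S) \<Longrightarrow> x \<in> filt_span (pred m) S m"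
    by blast
  have SJ: "snd ` set S \<subseteq> J"
    using S(1) by (auto simp: Q_def)
  then have Sc: "snd ` set S \<subseteq> carrier R"
    using subspace_carrier[OF Js] by auto
  have span_J: "filt_span {\<zero>} S n \<subseteq> J" for n
    using filt_span_least[OF J _ SJ] subspace_zero[OF Js] by simp
  note span_sub = filt_span_subspace[OF subspace_trivial Sc]
  have "x \<in> filt_span {\<zero>} S n" if "x \<in> J \<inter> \<Gamma> n" for x n
    using that
  proof (induction n arbitrary: x)
    case (0 x)
    then have "Q ((0, x) # S)"
      using S(1) by (simp add: Q_def)
    then have "x \<in> filt_span (pred 0) S 0"
      by (rule S(2))
    then show ?case by (simp add: filt_pred_def)
  next
    case (Suc n x)
    then have "Q ((Suc n, x) # S)"
      using S(1) by (simp add: Q_def)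
    then have "x \<in> filt_span (pred (Suc n)) S (Suc n)"
      by (rule S(2))
    then have "x \<in> \<Gamma> n <+>\<^bsub>R\<^esub> filt_span {\<zero>} S (Suc n)"
      using filt_span_decompose[OF pred_subspace Sc, of "Suc n" "Suc n"] by (auto simp: filt_pred_def)
    then obtain p y where py: "p \<in> \<Gamma> n" "y \<in> filt_span {\<zero>} S (Suc n)" "x = p \<oplus> y"
      by (auto simp: set_add_iff)
    have c: "p \<in> carrier R" "y \<in> carrier R"
      using py RF.filt_mem_carrier subspace_carrier[OF span_sub] by auto
    have "p = x \<ominus> y"
      using c py(3) by (simp add: a_minus_def a_assoc r_neg)
    moreover have "x \<ominus> y \<in> J"
      using subspace_diff[OF Js] Suc.prems py(2) span_J by blast
    ultimately have "p \<in> filt_span {\<zero>} S n"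
      using Suc.IH py by simp
    then have "p \<in> filt_span {\<zero>} S (Suc n)"
      using filt_span_mono[OF subspace_trivial subspace_trivial _ Sc, of n "Suc n"] by auto
    then show ?case
      using py submoduleE(5)[OF span_sub] by simp
  qed
  then show ?thesis
    using that SJ by blast
qed

text \<open>
  The finitely many elements that span \<open>J\<^sub>2\<close> in a filtered way are combinations of the generators
  with coefficients in one \<open>\<Gamma>\<^sub>c\<close>, so \<open>J\<^sub>2 \<inter> \<Gamma>\<^sub>n\<close> consists, modulo \<open>J\<^sub>1\<close>, of
  combinations with coefficients in \<open>\<Gamma>\<^bsub>n+c\<^esub>\<close>. Each generator contributes at most
  \<open>dim \<Gamma>\<^bsub>n+c\<^esub>\<close> modulo \<open>I\<close>, as \<open>I\<close> maps it into \<open>J\<^sub>1\<close>.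
\<close>

lemma left_generators_dim_upper_bound:
  assumes ideals: "ideal I R" "ideal J1 R" "ideal J2 R"
    and ann: "\<And>a x. \<lbrakk>a \<in> I; x \<in> J2\<rbrakk> \<Longrightarrow> a \<otimes> x \<in> J1"
    and es: "set es \<subseteq> J2" and gen: "\<And>x. x \<in> J2 \<Longrightarrow> \<exists>m. x \<in> filt_span J1 (map (Pair 0) es) m"
  obtains c where "\<And>n. dim_le J1 (length es * rel_dim I (\<Gamma> (n + c))) (J2 \<inter> \<Gamma> n)"
proof -
  note sub = ideals[THEN ideal_subspace]
  define E where "E = map (Pair (0::nat)) es"
  have Ec: "snd ` set E \<subseteq> carrier R"
    using es subspace_carrier[OF sub(3)] by (auto simp: E_def)
  note Esub = filt_span_subspace[OF sub(2) Ec]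
  obtain S where S: "snd ` set S \<subseteq> J2" "\<And>n. J2 \<inter> \<Gamma> n \<subseteq> filt_span {\<zero>} S n"
    using ideal_finitely_spanned[OF ideals(3)] by blast
  have Emono: "filt_span J1 E n \<subseteq> filt_span J1 E m" if "n \<le> m" for n m
    using filt_span_mono[OF sub(2) sub(2) _ Ec that] by simp
  have "\<exists>c. snd ` set S \<subseteq> filt_span J1 E c"
    using S(1)
  proof (induction S)
    case (Cons p S)
    then obtain c m where "snd ` set S \<subseteq> filt_span J1 E c" "snd p \<in> filt_span J1 E m"
      using gen[of "snd p"] by (auto simp: E_def)
    then have "snd ` set (p # S) \<subseteq> filt_span J1 E (max c m)"
      using Emono[of c "max c m"] Emono[of m "max c m"] by auto
    then show ?case by blast
  qed auto
  then obtain c where c: "snd ` set S \<subseteq> filt_span J1 E c" by blast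
  have span: "filt_span {\<zero>} S n \<subseteq> filt_span J1 E (n + c)" for n
    using c
  proof (induction S)
    case Nil
    then show ?case using subspace_zero[OF Esub] by simp
  next
    case (Cons p S)
    have "a \<otimes> snd p \<in> filt_span J1 E (n + c)" if "a \<in> \<Gamma> (n - fst p)" for a
    proof -
      have "a \<otimes> u \<in> J1" if "u \<in> J1" for u
        using ideal.I_l_closed[OF ideals(2) that] RF.filt_mem_carrier \<open>a \<in> \<Gamma> (n - fst p)\<close> by blast
      then have "a \<otimes> snd p \<in> filt_span J1 E (n - fst p + c)"
        using that Cons.prems by (intro filt_span_mult[OF _ sub(2) sub(2) _ Ec]) auto
      then show ?thesis
        using Emono[of "n - fst p + c" "n + c"] by auto
    qed
    then have "(\<lambda>a. a \<otimes> snd p) ` \<Gamma> (n - fst p) \<subseteq> filt_span J1 E (n + c)"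
      by auto
    then show ?case
      using Cons set_add_least[OF _ _ Esub] by simp
  qed
  have dim: "dim_le J1 (0 + (\<Sum>p\<leftarrow>E. if fst p \<le> n then rel_dim I (\<Gamma> n) else 0)) (filt_span J1 E n)" for n
  proof (rule filt_span_dim[OF sub(2) dim_le_refl])
    fix p assume "p \<in> set E"
    then have p: "fst p = 0" "snd p \<in> J2"
      using es by (auto simp: E_def)
    then show "dim_le J1 (rel_dim I (\<Gamma> n)) ((\<lambda>a. a \<otimes> snd p) ` \<Gamma> (n - fst p))"
      using ann subspace_carrier[OF sub(3)] filt_dim_le[OF sub(1)]
      by (intro dim_le_image[OF right_mult_linear sub(1)]) auto
  qed
  have "(\<Sum>p\<leftarrow>E. if fst p \<le> n then rel_dim I (\<Gamma> n) else 0) = length es * rel_dim I (\<Gamma> n)" for n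
    by (simp add: E_def comp_def sum_list_triv)
  then have "dim_le J1 (length es * rel_dim I (\<Gamma> (n + c))) (J2 \<inter> \<Gamma> n)" for n
    using dim_le_subset[OF dim[of "n + c"]] S(2)[of n] span[of n] by auto
  then show ?thesis by (rule that)
qed

text \<open>
  The subspace \<open>U + e\<^sub>0 \<Gamma>\<^sub>n + \<dots> + e\<^bsub>j-1\<^esub> \<Gamma>\<^sub>n\<close>. As \<open>j\<close> grows these subspaces form
  the flag along which the dimension is counted in the lower bound.
\<close>

primrec right_span :: "'a set \<Rightarrow> (nat \<Rightarrow> 'a) \<Rightarrow> nat \<Rightarrow> nat \<Rightarrow> 'a set"
  where
    "right_span U e n 0 = U"
  | "right_span U e n (Suc j) = right_span U e n j <+>\<^bsub>R\<^esub> (\<lambda>a. e j \<otimes> a) ` \<Gamma> n"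

lemma right_span_subspace:
  "submodule U K R \<Longrightarrow> (\<And>i. i < j \<Longrightarrow> e i \<in> carrier R) \<Longrightarrow> submodule (right_span U e n j) K R"
  by (induction j) (auto intro!: set_add_subspace image_subspace left_mult_linear subspace)

lemma right_span_base:
  assumes "submodule U K R"
  shows "(\<And>i. i < j \<Longrightarrow> e i \<in> carrier R) \<Longrightarrow> U \<subseteq> right_span U e n j"
proof (induction j)
  case (Suc j)
  then have "U \<subseteq> right_span U e n j"
    by simp
  also have "\<dots> \<subseteq> right_span U e n (Suc j)"
    using set_add_left[OF right_span_subspace[OF assms] image_subspace[OF left_mult_linear subspace]] Suc.prems
    by simp
  finally show ?case .
qed simp

lemma right_span_combination:
  assumes U: "U \<subseteq> carrier R" and e: "\<And>i. i < j \<Longrightarrow> e i \<in> carrier R" and x: "x \<in> right_span U e n j"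
  obtains u a where "u \<in> U" "a \<in> {..<j} \<rightarrow> \<Gamma> n" "x = u \<oplus> (\<Oplus>i\<in>{..<j}. e i \<otimes> a i)"
proof -
  from e x have "\<exists>u\<in>U. \<exists>a\<in>{..<j} \<rightarrow> \<Gamma> n. x = u \<oplus> (\<Oplus>i\<in>{..<j}. e i \<otimes> a i)"
  proof (induction j arbitrary: x)
    case 0
    then have "x \<in> U" "x \<in> carrier R"
      using U by auto
    then show ?case
      by (intro bexI[of _ x]) auto
  next
    case (Suc j)
    obtain v b where v: "v \<in> right_span U e n j" "b \<in> \<Gamma> n" "x = v \<oplus> e j \<otimes> b"
      using Suc.prems by (auto simp: set_add_iff)
    obtain u a where u: "u \<in> U" "a \<in> {..<j} \<rightarrow> \<Gamma> n" "v = u \<oplus> (\<Oplus>i\<in>{..<j}. e i \<otimes> a i)"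
      using Suc.IH[OF _ v(1)] Suc.prems by auto
    define a' where "a' = a(j := b)"
    have a': "a' \<in> {..<Suc j} \<rightarrow> \<Gamma> n"
      using u v by (auto simp: a'_def less_Suc_eq)
    have summand: "e i \<otimes> a' i \<in> carrier R" if "i < Suc j" for i
      using that a' Suc.prems(1) RF.filt_mem_carrier by (intro m_closed) auto
    have summand': "e i \<otimes> a i \<in> carrier R" if "i < j" for i
      using summand[of i] that by (simp add: a'_def)
    have "(\<Oplus>i\<in>{..<Suc j}. e i \<otimes> a' i) = e j \<otimes> a' j \<oplus> (\<Oplus>i\<in>{..<j}. e i \<otimes> a' i)"
      unfolding lessThan_Suc using summand by (intro finsum_insert) auto
    also have "(\<Oplus>i\<in>{..<j}. e i \<otimes> a' i) = (\<Oplus>i\<in>{..<j}. e i \<otimes> a i)"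
      using summand' by (intro finsum_cong') (auto simp: a'_def)
    finally have "(\<Oplus>i\<in>{..<Suc j}. e i \<otimes> a' i) = e j \<otimes> b \<oplus> (\<Oplus>i\<in>{..<j}. e i \<otimes> a i)"
      by (simp add: a'_def)
    moreover have "(\<Oplus>i\<in>{..<j}. e i \<otimes> a i) \<in> carrier R"
      using summand' by (intro finsum_closed) auto
    moreover have "e j \<otimes> b \<in> carrier R" "u \<in> carrier R"
      using summand[of j] u U by (auto simp: a'_def)
    ultimately have "x = u \<oplus> (\<Oplus>i\<in>{..<Suc j}. e i \<otimes> a' i)"
      using u v by (simp add: a_ac)
    then show ?case
      using u a' by blast
  qed
  then show ?thesis
    using that by blast
qed

text \<open>
  Consecutive members of the flag \<open>V\<^sub>j = J\<^sub>1 + e\<^sub>0 \<Gamma>\<^sub>n + \<dots> + e\<^bsub>j-1\<^esub> \<Gamma>\<^sub>n\<close> differ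
  by at least the dimension of \<open>\<Gamma>\<^sub>n\<close> modulo \<open>I\<close>: by independence, \<open>e\<^sub>j a \<in> V\<^sub>j\<close> forces
  \<open>a \<in> I\<close>.
\<close>

lemma right_independent_dim_lower_bound:
  assumes ideals: "ideal I R" "ideal J1 R" "ideal J2 R" and "J1 \<subseteq> J2"
    and e: "\<And>i. i < t \<Longrightarrow> e i \<in> J2 \<inter> \<Gamma> d"
    and indep: "\<And>a i. \<lbrakk>a \<in> {..<t} \<rightarrow> carrier R; (\<Oplus>i\<in>{..<t}. e i \<otimes> a i) \<in> J1; i < t\<rbrakk> \<Longrightarrow> a i \<in> I"
    and dim: "dim_le J1 k (J2 \<inter> \<Gamma> (n + d))"
  shows "t * rel_dim I (\<Gamma> n) \<le> k"
proof -
  note sub = ideals[THEN ideal_subspace]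
  define V where "V = right_span J1 e n"
  have ec: "e i \<in> carrier R" if "i < t" for i
    using e[OF that] subspace_carrier[OF sub(3)] by blast
  have Vs: "submodule (V j) K R" if "j \<le> t" for j
    unfolding V_def using that ec by (intro right_span_subspace sub) auto
  have step_indep: "a \<in> I" if j: "j < t" and a: "a \<in> \<Gamma> n" and ea: "e j \<otimes> a \<in> V j" for j a
  proof -
    obtain u b where u: "u \<in> J1" "b \<in> {..<j} \<rightarrow> \<Gamma> n" "e j \<otimes> a = u \<oplus> (\<Oplus>i\<in>{..<j}. e i \<otimes> b i)"
      using right_span_combination[OF submoduleE(1)[OF sub(2)] _ ea[unfolded V_def]] j ec by auto
    \<comment> \<open>The equation \<open>e\<^sub>j a = u + \<Sum> e\<^sub>i b\<^sub>i\<close>, rewritten as a relation modulo \<open>J\<^sub>1\<close> among all \<open>t\<close> elements.\<close>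
    define b' where "b' = (\<lambda>i. if i < j then b i else if i = j then \<ominus> a else \<zero>)"
    have ac: "a \<in> carrier R" "u \<in> carrier R"
      using a u RF.filt_mem_carrier subspace_carrier[OF sub(2)] by auto
    have bc: "b i \<in> carrier R" if "i < j" for i
      using that u(2) RF.filt_mem_carrier by auto
    have b': "b' \<in> {..<t} \<rightarrow> carrier R"
      using ac bc by (auto simp: b'_def)
    have sumc: "(\<Oplus>i\<in>{..<j}. e i \<otimes> b i) \<in> carrier R"
      using ec bc j by (intro finsum_closed Pi_I m_closed) auto
    have "(\<Oplus>i\<in>{..<t}. e i \<otimes> b' i) = (\<Oplus>i\<in>{..<Suc j}. e i \<otimes> b' i)"
      using ec b' j by (intro add.finprod_mono_neutral_cong_right) (auto simp: b'_def Pi_def)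
    also have "\<dots> = e j \<otimes> b' j \<oplus> (\<Oplus>i\<in>{..<j}. e i \<otimes> b' i)"
      unfolding lessThan_Suc using ec b' j by (intro finsum_insert) (auto simp: Pi_def)
    also have "(\<Oplus>i\<in>{..<j}. e i \<otimes> b' i) = (\<Oplus>i\<in>{..<j}. e i \<otimes> b i)"
      using ec bc j by (intro finsum_cong') (auto simp: b'_def)
    also have "e j \<otimes> b' j = \<ominus> (u \<oplus> (\<Oplus>i\<in>{..<j}. e i \<otimes> b i))"
      using u(3) ac ec[OF j] by (simp add: b'_def r_minus)
    also have "\<dots> \<oplus> (\<Oplus>i\<in>{..<j}. e i \<otimes> b i) = \<ominus> u"
      using ac sumc by (simp add: minus_add a_assoc l_neg)
    finally have "(\<Oplus>i\<in>{..<t}. e i \<otimes> b' i) \<in> J1"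
      using submoduleE(3)[OF sub(2) u(1)] by (simp only:)
    then have "b' j \<in> I"
      by (rule indep[OF b' _ j])
    then have "\<ominus> (\<ominus> a) \<in> I"
      using submoduleE(3)[OF sub(1)] by (simp add: b'_def)
    then show ?thesis
      using ac by simp
  qed
  have lower: "j * rel_dim I (\<Gamma> n) \<le> l" if "j \<le> t" "dim_le J1 l (V j)" for j l
    using that
  proof (induction j arbitrary: l)
    case (Suc j)
    have V_Suc: "V (Suc j) = V j <+>\<^bsub>R\<^esub> (\<lambda>a. e j \<otimes> a) ` \<Gamma> n"
      by (simp add: V_def)
    have lin: "linear_map (\<lambda>a. e j \<otimes> a)"
      using Suc.prems ec by (intro left_mult_linear) auto
    have Vj: "submodule (V j) K R" "submodule (V (Suc j)) K R"
      using Suc.prems Vs by auto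
    have "J1 \<subseteq> V j"
      unfolding V_def using Suc.prems ec by (intro right_span_base sub) auto
    moreover have "V j \<subseteq> V (Suc j)"
      unfolding V_Suc using set_add_left[OF Vj(1) image_subspace[OF lin subspace]] .
    ultimately obtain i i' where i: "i + i' = l" "dim_le J1 i (V j)" "dim_le (V j) i' (V (Suc j))"
      using dim_le_split[OF sub(2) Vj] Suc.prems by blast
    have "dim_le (V j) i' ((\<lambda>a. e j \<otimes> a) ` \<Gamma> n)"
      using dim_le_subset[OF i(3)] set_add_right[OF Vj(1) image_subspace[OF lin subspace]]
      by (simp add: V_Suc)
    then have "dim_le {a \<in> \<Gamma> n. e j \<otimes> a \<in> V j} i' (\<Gamma> n)"
      using dim_le_preimage[OF lin Vj(1) subspace] by blast
    moreover have "{a \<in> \<Gamma> n. e j \<otimes> a \<in> V j} \<subseteq> I"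
      using step_indep[of j] Suc.prems by auto
    ultimately have "dim_le I i' (\<Gamma> n)"
      by (rule dim_le_base_mono)
    then have "rel_dim I (\<Gamma> n) \<le> i'"
      by (rule rel_dim_le)
    moreover have "j * rel_dim I (\<Gamma> n) \<le> i"
      using Suc.IH[OF _ i(2)] Suc.prems by simp
    ultimately show ?case
      using i(1) by simp
  qed simp
  have WJ: "submodule (J2 \<inter> \<Gamma> (n + d)) K R"
    using subspace_Int[OF sub(3) subspace] .
  define W where "W = J1 <+>\<^bsub>R\<^esub> (J2 \<inter> \<Gamma> (n + d))"
  have W: "submodule W K R" "J1 \<subseteq> W" "J2 \<inter> \<Gamma> (n + d) \<subseteq> W"
    unfolding W_def using set_add_subspace[OF sub(2) WJ] set_add_left[OF sub(2) WJ]
      set_add_right[OF sub(2) WJ] by auto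
  have "V j \<subseteq> W" if "j \<le> t" for j
    using that
  proof (induction j)
    case (Suc j)
    have "e j \<otimes> a \<in> J2 \<inter> \<Gamma> (n + d)" if "a \<in> \<Gamma> n" for a
      using that e[of j] Suc.prems mult_mem[of "e j" d a n] ideal.I_r_closed[OF ideals(3)]
        RF.filt_mem_carrier by (auto simp: add.commute)
    then have "(\<lambda>a. e j \<otimes> a) ` \<Gamma> n \<subseteq> W"
      using W(3) by blast
    then show ?case
      using Suc set_add_least[OF _ _ W(1)] by (simp add: V_def)
  qed (use W in \<open>simp add: V_def\<close>)
  then have "V t \<subseteq> W"
    by simp
  moreover have "dim_le J1 k W"
    using dim_le_add[OF sub(2) dim_le_refl dim] by (simp add: W_def)
  ultimately have "dim_le J1 k (V t)"
    using dim_le_subset by blast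
  then show ?thesis
    by (rule lower[OF order_refl])
qed

text \<open>
  The two estimates combine to \<open>t f n \<le> s f (n + d + c)\<close> for \<open>f n\<close> the dimension of
  \<open>\<Gamma>\<^sub>n\<close> modulo \<open>I\<close>, which forces \<open>t \<le> s\<close> by subexponential growth. The properness of
  \<open>J\<^sub>1 \<subset> J\<^sub>2\<close> enters as \<open>f 0 > 0\<close>: if \<open>1 \<in> I\<close>, then \<open>J\<^sub>2 = 1 J\<^sub>2 \<subseteq> J\<^sub>1\<close>.
\<close>

theorem free_rank_le:
  fixes s t :: nat
  assumes ideals: "ideal I R" "ideal J1 R" "ideal J2 R" and JJ: "J1 \<subset> J2"
    and ann: "\<And>a x. \<lbrakk>a \<in> I; x \<in> J2\<rbrakk> \<Longrightarrow> a \<otimes> x \<in> J1"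
    and x: "\<And>i. i < s \<Longrightarrow> x i \<in> J2"
    and gen: "\<And>z. z \<in> J2 \<Longrightarrow> \<exists>a \<in> {..<s} \<rightarrow> carrier R. \<exists>u \<in> J1. z = u \<oplus> (\<Oplus>i\<in>{..<s}. a i \<otimes> x i)"
    and y: "\<And>i. i < t \<Longrightarrow> y i \<in> J2"
    and indep: "\<And>a i. \<lbrakk>a \<in> {..<t} \<rightarrow> carrier R; (\<Oplus>i\<in>{..<t}. y i \<otimes> a i) \<in> J1; i < t\<rbrakk> \<Longrightarrow> a i \<in> I"
  shows "t \<le> s"
proof (rule ccontr)
  assume "\<not> t \<le> s"
  note sub = ideals[THEN ideal_subspace]
  define es where "es = map x [0..<s]"
  have level: "\<exists>m. z \<in> \<Gamma> m" if "z \<in> carrier R" for z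
    using that exhaustive by blast
  have xc: "x i \<in> carrier R" if "i < s" for i
    using x[OF that] subspace_carrier[OF sub(3)] by blast
  \<comment> \<open>The coefficients of one combination lie in a common \<open>\<Gamma>\<^sub>m\<close>. The list is reversed because a longer sum adds its last summand at the head.\<close>
  have span: "\<exists>m. u \<oplus> (\<Oplus>i\<in>{..<j}. a i \<otimes> x i) \<in> filt_span J1 (map (Pair 0) (rev (map x [0..<j]))) m"
    if "u \<in> J1" "a \<in> {..<s} \<rightarrow> carrier R" "j \<le> s" for u a j
    using that(3)
  proof (induction j)
    case 0
    then show ?case
      using that subspace_carrier[OF sub(2)] by auto
  next
    case (Suc j)
    define E where "E = map (Pair (0::nat)) (rev (map x [0..<j]))"
    have Ec: "snd ` set E \<subseteq> carrier R"
      using xc Suc.prems by (auto simp: E_def)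
    obtain m where m: "u \<oplus> (\<Oplus>i\<in>{..<j}. a i \<otimes> x i) \<in> filt_span J1 E m"
      using Suc by (auto simp: E_def)
    have ac: "a i \<in> carrier R" if "i \<le> j" for i
      using that \<open>a \<in> _\<close> Suc.prems by auto
    obtain k where k: "a j \<in> \<Gamma> k"
      using level ac by blast
    define l where "l = max m k"
    have "u \<oplus> (\<Oplus>i\<in>{..<j}. a i \<otimes> x i) \<in> filt_span J1 E l"
      using m filt_span_mono[OF sub(2) sub(2) order_refl Ec, of m l] by (auto simp: l_def)
    moreover have "a j \<in> \<Gamma> l"
      using k RF.filt_mono[of k l] by (auto simp: l_def)
    moreover have "u \<oplus> (\<Oplus>i\<in>{..<Suc j}. a i \<otimes> x i) = (u \<oplus> (\<Oplus>i\<in>{..<j}. a i \<otimes> x i)) \<oplus> a j \<otimes> x j"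
    proof -
      have t: "a i \<otimes> x i \<in> carrier R" if "i \<le> j" for i
        using that ac xc Suc.prems by (intro m_closed) auto
      then have "(\<Oplus>i\<in>{..<j}. a i \<otimes> x i) \<in> carrier R"
        by (intro finsum_closed) auto
      moreover have "(\<Oplus>i\<in>{..<Suc j}. a i \<otimes> x i) = a j \<otimes> x j \<oplus> (\<Oplus>i\<in>{..<j}. a i \<otimes> x i)"
        unfolding lessThan_Suc using t by (intro finsum_insert) auto
      ultimately show ?thesis
        using t[of j] subspace_carrier[OF sub(2) that(1)] by (simp add: a_ac)
    qed
    ultimately have "u \<oplus> (\<Oplus>i\<in>{..<Suc j}. a i \<otimes> x i) \<in> filt_span J1 ((0, x j) # E) l"
      by (auto simp: set_add_iff)
    then show ?case
      by (auto simp: E_def)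
  qed
  have "\<exists>m. z \<in> filt_span J1 (map (Pair 0) (rev es)) m" if "z \<in> J2" for z
    using gen[OF that] span by (auto simp: es_def)
  moreover have "set (rev es) \<subseteq> J2"
    using x by (auto simp: es_def)
  ultimately obtain c where c: "\<And>n. dim_le J1 (length (rev es) * rel_dim I (\<Gamma> (n + c))) (J2 \<inter> \<Gamma> n)"
    using left_generators_dim_upper_bound[OF ideals ann] by blast
  have "\<exists>d. \<forall>i<j. y i \<in> \<Gamma> d" if "j \<le> t" for j
    using that
  proof (induction j)
    case (Suc j)
    obtain k where "y j \<in> \<Gamma> k"
      using level[OF subspace_carrier[OF sub(3) y[of j]]] Suc.prems by auto
    moreover obtain d where "\<forall>i<j. y i \<in> \<Gamma> d"
      using Suc by auto
    ultimately have "\<forall>i<Suc j. y i \<in> \<Gamma> (max d k)"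
      using RF.filt_mono[of d "max d k"] RF.filt_mono[of k "max d k"] by (auto simp: less_Suc_eq)
    then show ?case by blast
  qed simp
  then obtain d where d: "y i \<in> \<Gamma> d" if "i < t" for i
    by blast
  have "t * rel_dim I (\<Gamma> n) \<le> length (rev es) * rel_dim I (\<Gamma> (n + d + c))" for n
  proof (rule right_independent_dim_lower_bound[OF ideals])
    show "J1 \<subseteq> J2"
      using JJ by blast
    show "y i \<in> J2 \<inter> \<Gamma> d" if "i < t" for i
      using that y d by blast
    show "dim_le J1 (length (rev es) * rel_dim I (\<Gamma> (n + d + c))) (J2 \<inter> \<Gamma> (n + d))"
      by (rule c)
  qed (rule indep)
  then have ratio: "t * rel_dim I (\<Gamma> n) \<le> s * rel_dim I (\<Gamma> (n + (d + c)))" for n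
    by (simp add: es_def add.assoc)
  have pos: "rel_dim I (\<Gamma> 0) > 0"
  proof (rule ccontr)
    assume "\<not> ?thesis"
    then have "dim_le I 0 (\<Gamma> 0)"
      using filt_dim_le[OF sub(1), of 0] by simp
    then have "\<one> \<in> I"
      using one_mem by (auto simp: dim_le_def)
    then have "z \<in> J1" if "z \<in> J2" for z
      using ann[OF _ that] subspace_carrier[OF sub(3) that] by force
    then show False using JJ by blast
  qed
  show False
    using no_shifted_ratio_of_subexponential_growth[OF ratio _ pos filt_dim_mono[OF sub(1)]
      filt_dim_subexponential] \<open>\<not> t \<le> s\<close> by simp
qed

end

section \<open>Lifting bases of the subquotient\<close>

lemma subquotient_finsum:
  assumes "abelian_group R" "additive_subgroup U R" "additive_subgroup V R" "finite A"
  shows "(\<And>i. i \<in> A \<Longrightarrow> x i \<in> V) \<Longrightarrow>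
    (\<Oplus>\<^bsub>subquotient R V U\<^esub>i\<in>A. U +>\<^bsub>R\<^esub> x i) = U +>\<^bsub>R\<^esub> (\<Oplus>\<^bsub>R\<^esub>i\<in>A. x i) \<and> (\<Oplus>\<^bsub>R\<^esub>i\<in>A. x i) \<in> V"
  using assms(4)
proof (induction A rule: finite_induct)
  case empty
  interpret R: abelian_group R by fact
  interpret V: additive_subgroup V R by fact
  interpret Q: abelian_group "subquotient R V U"
    using assms(1-3) by (rule subquotient_abelian_group)
  show ?case
    using R.a_coset_add_zero[OF additive_subgroup.a_subset[OF assms(2)]] by (simp add: subquotient_simps)
next
  case (insert a A)
  interpret R: abelian_group R by fact
  interpret U: abelian_subgroup U R
    using assms by (simp add: abelian_subgroupI3)
  interpret V: additive_subgroup V R by fact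
  interpret Q: abelian_group "subquotient R V U"
    using assms(1-3) by (rule subquotient_abelian_group)
  have "(\<Oplus>\<^bsub>subquotient R V U\<^esub>i\<in>insert a A. U +>\<^bsub>R\<^esub> x i)
      = (U +>\<^bsub>R\<^esub> x a) \<oplus>\<^bsub>subquotient R V U\<^esub> (\<Oplus>\<^bsub>subquotient R V U\<^esub>i\<in>A. U +>\<^bsub>R\<^esub> x i)"
    using insert by (intro Q.finsum_insert) (auto simp: subquotient_simps)
  moreover have "(\<Oplus>\<^bsub>R\<^esub>i\<in>insert a A. x i) = x a \<oplus>\<^bsub>R\<^esub> (\<Oplus>\<^bsub>R\<^esub>i\<in>A. x i)"
    using insert by (intro R.finsum_insert) auto
  ultimately show ?case
    using insert by (simp add: subquotient_simps U.a_rcos_sum)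
qed

lemma left_free_generators:
  assumes ideals: "ideal I R" "ideal J1 R" "ideal J2 R"
    and ann: "\<And>a x. \<lbrakk>a \<in> I; x \<in> J2\<rbrakk> \<Longrightarrow> a \<otimes>\<^bsub>R\<^esub> x \<in> J1"
    and free: "left_free_of_rank (R Quot I) (subquotient R J2 J1) (rcoset_mult R J1) s"
  obtains x where "\<And>i. i < s \<Longrightarrow> x i \<in> J2"
    "\<And>z. z \<in> J2 \<Longrightarrow> \<exists>a \<in> {..<s} \<rightarrow> carrier R. \<exists>u \<in> J1. z = u \<oplus>\<^bsub>R\<^esub> (\<Oplus>\<^bsub>R\<^esub>i\<in>{..<s}. a i \<otimes>\<^bsub>R\<^esub> x i)"
proof -
  interpret I: ideal I R by fact
  interpret J1: ideal J1 R by fact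
  interpret J2: ideal J2 R by fact
  interpret Q: abelian_group "subquotient R J2 J1"
    by (rule subquotient_abelian_group[OF I.is_abelian_group J1.is_additive_subgroup J2.is_additive_subgroup])
  have "\<exists>e \<in> {..<s} \<rightarrow> carrier (subquotient R J2 J1). \<forall>z \<in> carrier (subquotient R J2 J1).
      \<exists>!c. c \<in> {..<s} \<rightarrow>\<^sub>E carrier (R Quot I) \<and>
      z = (\<Oplus>\<^bsub>subquotient R J2 J1\<^esub>i\<in>{..<s}. rcoset_mult R J1 (c i) (e i))"
    using free unfolding left_free_of_rank_def by (rule conjunct2)
  then obtain e where e: "e \<in> {..<s} \<rightarrow> carrier (subquotient R J2 J1)"
    and free_basis: "\<forall>z \<in> carrier (subquotient R J2 J1). \<exists>!c. c \<in> {..<s} \<rightarrow>\<^sub>E carrier (R Quot I) \<and>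
      z = (\<Oplus>\<^bsub>subquotient R J2 J1\<^esub>i\<in>{..<s}. rcoset_mult R J1 (c i) (e i))"
    by (rule bexE)
  have basis: "\<exists>!c. c \<in> {..<s} \<rightarrow>\<^sub>E carrier (R Quot I) \<and>
      z = (\<Oplus>\<^bsub>subquotient R J2 J1\<^esub>i\<in>{..<s}. rcoset_mult R J1 (c i) (e i))" if "z \<in> carrier (subquotient R J2 J1)" for z
    using free_basis that by (rule bspec)
  have "\<forall>i\<in>{..<s}. \<exists>x\<in>J2. e i = J1 +>\<^bsub>R\<^esub> x"
    using e by (auto simp: subquotient_simps)
  then obtain x where "\<forall>i\<in>{..<s}. x i \<in> J2 \<and> e i = J1 +>\<^bsub>R\<^esub> x i"
    unfolding Bex_def by (elim bchoice[THEN exE])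
  then have x: "x i \<in> J2 \<and> e i = J1 +>\<^bsub>R\<^esub> x i" if "i < s" for i
    using that by simp
  have "\<exists>a \<in> {..<s} \<rightarrow> carrier R. \<exists>u \<in> J1. z = u \<oplus>\<^bsub>R\<^esub> (\<Oplus>\<^bsub>R\<^esub>i\<in>{..<s}. a i \<otimes>\<^bsub>R\<^esub> x i)"
    if z: "z \<in> J2" for z
  proof -
    have "J1 +>\<^bsub>R\<^esub> z \<in> carrier (subquotient R J2 J1)"
      using z by (simp add: subquotient_simps)
    then obtain c where c: "c \<in> {..<s} \<rightarrow>\<^sub>E carrier (R Quot I)"
      and eq: "J1 +>\<^bsub>R\<^esub> z = (\<Oplus>\<^bsub>subquotient R J2 J1\<^esub>i\<in>{..<s}. rcoset_mult R J1 (c i) (e i))"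
      using basis[THEN ex1_implies_ex] by blast
    have "\<forall>i\<in>{..<s}. \<exists>r\<in>carrier R. c i = I +>\<^bsub>R\<^esub> r"
      using c by (fastforce simp: FactRing_simps PiE_iff)
    then obtain a where "\<forall>i\<in>{..<s}. a i \<in> carrier R \<and> c i = I +>\<^bsub>R\<^esub> a i"
      unfolding Bex_def by (elim bchoice[THEN exE])
    then have a: "a i \<in> carrier R \<and> c i = I +>\<^bsub>R\<^esub> a i" if "i < s" for i
      using that by simp
    have ax: "a i \<otimes>\<^bsub>R\<^esub> x i \<in> J2" if "i < s" for i
      using a[OF that] x[OF that] J2.I_l_closed by blast
    have "rcoset_mult R J1 (c i) (e i) = J1 +>\<^bsub>R\<^esub> (a i \<otimes>\<^bsub>R\<^esub> x i)" if "i < s" for i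
    proof -
      have "rcoset_mult R J1 (I +>\<^bsub>R\<^esub> a i) (J1 +>\<^bsub>R\<^esub> x i) = J1 +>\<^bsub>R\<^esub> (a i \<otimes>\<^bsub>R\<^esub> x i)"
        using a[OF that] x[OF that] ann
        by (intro rcoset_mult_well_defined[OF I.ring_axioms I.is_additive_subgroup
          J1.is_additive_subgroup J1.is_additive_subgroup]) (auto simp: J2.a_Hcarr J1.I_l_closed I.a_Hcarr)
      then show ?thesis
        using a[OF that] x[OF that] by simp
    qed
    then have "J1 +>\<^bsub>R\<^esub> z = (\<Oplus>\<^bsub>subquotient R J2 J1\<^esub>i\<in>{..<s}. J1 +>\<^bsub>R\<^esub> (a i \<otimes>\<^bsub>R\<^esub> x i))"
      unfolding eq using ax by (intro Q.finsum_cong') (auto simp: subquotient_simps)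
    also have "\<dots> = J1 +>\<^bsub>R\<^esub> (\<Oplus>\<^bsub>R\<^esub>i\<in>{..<s}. a i \<otimes>\<^bsub>R\<^esub> x i)"
      by (rule conjunct1[OF subquotient_finsum[OF I.is_abelian_group J1.is_additive_subgroup
        J2.is_additive_subgroup finite_lessThan]]) (use ax in simp)
    finally have "z \<in> J1 +>\<^bsub>R\<^esub> (\<Oplus>\<^bsub>R\<^esub>i\<in>{..<s}. a i \<otimes>\<^bsub>R\<^esub> x i)"
      using J1.a_rcos_self[OF J2.a_Hcarr[OF z]] by simp
    then obtain u where "u \<in> J1" "z = u \<oplus>\<^bsub>R\<^esub> (\<Oplus>\<^bsub>R\<^esub>i\<in>{..<s}. a i \<otimes>\<^bsub>R\<^esub> x i)"
      by (auto simp: a_r_coset_def')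
    then show ?thesis
      using a by blast
  qed
  then show ?thesis
    using that x by blast
qed

text \<open>
  A relation among the lifted basis elements modulo \<open>J\<^sub>1\<close> gives coordinates of the zero coset, and
  these have to agree with the trivial ones.
\<close>

lemma right_free_independent:
  assumes ideals: "ideal I R" "ideal J1 R" "ideal J2 R"
    and ann: "\<And>a x. \<lbrakk>a \<in> I; x \<in> J2\<rbrakk> \<Longrightarrow> x \<otimes>\<^bsub>R\<^esub> a \<in> J1"
    and free: "right_free_of_rank (R Quot I) (subquotient R J2 J1) (rcoset_mult R J1) t"
  obtains y where "\<And>i. i < t \<Longrightarrow> y i \<in> J2"
    "\<And>a i. \<lbrakk>a \<in> {..<t} \<rightarrow> carrier R; (\<Oplus>\<^bsub>R\<^esub>i\<in>{..<t}. y i \<otimes>\<^bsub>R\<^esub> a i) \<in> J1; i < t\<rbrakk> \<Longrightarrow> a i \<in> I"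
proof -
  interpret I: ideal I R by fact
  interpret J1: ideal J1 R by fact
  interpret J2: ideal J2 R by fact
  interpret Q: abelian_group "subquotient R J2 J1"
    by (rule subquotient_abelian_group[OF I.is_abelian_group J1.is_additive_subgroup J2.is_additive_subgroup])
  have "\<exists>e \<in> {..<t} \<rightarrow> carrier (subquotient R J2 J1). \<forall>z \<in> carrier (subquotient R J2 J1).
      \<exists>!c. c \<in> {..<t} \<rightarrow>\<^sub>E carrier (R Quot I) \<and>
      z = (\<Oplus>\<^bsub>subquotient R J2 J1\<^esub>i\<in>{..<t}. rcoset_mult R J1 (e i) (c i))"
    using free unfolding right_free_of_rank_def by (rule conjunct2)
  then obtain e where e: "e \<in> {..<t} \<rightarrow> carrier (subquotient R J2 J1)"
    and free_basis: "\<forall>z \<in> carrier (subquotient R J2 J1). \<exists>!c. c \<in> {..<t} \<rightarrow>\<^sub>E carrier (R Quot I) \<and>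
      z = (\<Oplus>\<^bsub>subquotient R J2 J1\<^esub>i\<in>{..<t}. rcoset_mult R J1 (e i) (c i))"
    by (rule bexE)
  have basis: "\<exists>!c. c \<in> {..<t} \<rightarrow>\<^sub>E carrier (R Quot I) \<and>
      z = (\<Oplus>\<^bsub>subquotient R J2 J1\<^esub>i\<in>{..<t}. rcoset_mult R J1 (e i) (c i))" if "z \<in> carrier (subquotient R J2 J1)" for z
    using free_basis that by (rule bspec)
  have "\<forall>i\<in>{..<t}. \<exists>y\<in>J2. e i = J1 +>\<^bsub>R\<^esub> y"
    using e by (auto simp: subquotient_simps)
  then obtain y where "\<forall>i\<in>{..<t}. y i \<in> J2 \<and> e i = J1 +>\<^bsub>R\<^esub> y i"
    unfolding Bex_def by (elim bchoice[THEN exE])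
  then have y: "y i \<in> J2 \<and> e i = J1 +>\<^bsub>R\<^esub> y i" if "i < t" for i
    using that by simp
  define coords where "coords a = (\<lambda>i\<in>{..<t}. I +>\<^bsub>R\<^esub> a i)" for a
  have coords: "coords a \<in> {..<t} \<rightarrow>\<^sub>E carrier (R Quot I) \<and>
      J1 = (\<Oplus>\<^bsub>subquotient R J2 J1\<^esub>i\<in>{..<t}. rcoset_mult R J1 (e i) (coords a i))"
    if a: "a \<in> {..<t} \<rightarrow> carrier R" and rel: "(\<Oplus>\<^bsub>R\<^esub>i\<in>{..<t}. y i \<otimes>\<^bsub>R\<^esub> a i) \<in> J1" for a
  proof -
    have ya: "y i \<otimes>\<^bsub>R\<^esub> a i \<in> J2" if "i < t" for i
      using a y[OF that] J2.I_r_closed that by auto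
    have "rcoset_mult R J1 (e i) (coords a i) = J1 +>\<^bsub>R\<^esub> (y i \<otimes>\<^bsub>R\<^esub> a i)" if i: "i < t" for i
    proof -
      have "a i \<in> carrier R"
        using a i by auto
      then have "rcoset_mult R J1 (J1 +>\<^bsub>R\<^esub> y i) (I +>\<^bsub>R\<^esub> a i) = J1 +>\<^bsub>R\<^esub> (y i \<otimes>\<^bsub>R\<^esub> a i)"
        using y[OF i] ann
        by (intro rcoset_mult_well_defined[OF I.ring_axioms J1.is_additive_subgroup
          I.is_additive_subgroup J1.is_additive_subgroup]) (auto simp: J2.a_Hcarr J1.I_r_closed I.a_Hcarr)
      then show ?thesis
        using y[OF i] i by (simp add: coords_def)
    qed
    then have "(\<Oplus>\<^bsub>subquotient R J2 J1\<^esub>i\<in>{..<t}. rcoset_mult R J1 (e i) (coords a i))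
        = (\<Oplus>\<^bsub>subquotient R J2 J1\<^esub>i\<in>{..<t}. J1 +>\<^bsub>R\<^esub> (y i \<otimes>\<^bsub>R\<^esub> a i))"
      using ya by (intro Q.finsum_cong') (auto simp: subquotient_simps)
    also have "\<dots> = J1 +>\<^bsub>R\<^esub> (\<Oplus>\<^bsub>R\<^esub>i\<in>{..<t}. y i \<otimes>\<^bsub>R\<^esub> a i)"
      by (rule conjunct1[OF subquotient_finsum[OF I.is_abelian_group J1.is_additive_subgroup
        J2.is_additive_subgroup finite_lessThan]]) (use ya in simp)
    also have "\<dots> = J1"
      using rel J1.a_Hcarr by (intro I.a_coset_join2 J1.a_subgroup) auto
    finally show ?thesis
      using a by (auto simp: coords_def FactRing_simps)
  qed
  have "a i \<in> I" if a: "a \<in> {..<t} \<rightarrow> carrier R" "(\<Oplus>\<^bsub>R\<^esub>i\<in>{..<t}. y i \<otimes>\<^bsub>R\<^esub> a i) \<in> J1" and i: "i < t" for a i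
  proof -
    have yc: "y i \<in> carrier R" if "i < t" for i
      using y[OF that] J2.a_Hcarr by blast
    have "(\<Oplus>\<^bsub>R\<^esub>i\<in>{..<t}. y i \<otimes>\<^bsub>R\<^esub> \<zero>\<^bsub>R\<^esub>) = (\<Oplus>\<^bsub>R\<^esub>i\<in>{..<t}. \<zero>\<^bsub>R\<^esub>)"
      using yc by (intro I.finsum_cong') auto
    then have "(\<Oplus>\<^bsub>R\<^esub>i\<in>{..<t}. y i \<otimes>\<^bsub>R\<^esub> \<zero>\<^bsub>R\<^esub>) \<in> J1"
      by (simp add: I.finsum_zero)
    then have zero: "coords (\<lambda>_. \<zero>\<^bsub>R\<^esub>) \<in> {..<t} \<rightarrow>\<^sub>E carrier (R Quot I) \<and>
      J1 = (\<Oplus>\<^bsub>subquotient R J2 J1\<^esub>i\<in>{..<t}. rcoset_mult R J1 (e i) (coords (\<lambda>_. \<zero>\<^bsub>R\<^esub>) i))"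
      by (intro coords) auto
    have "J1 \<in> carrier (subquotient R J2 J1)"
      using Q.zero_closed by (simp add: subquotient_simps)
    then have "coords a = coords (\<lambda>_. \<zero>\<^bsub>R\<^esub>)"
      by (rule ex1E[OF basis]) (use coords[OF a] zero in metis)
    then have "coords a i = coords (\<lambda>_. \<zero>\<^bsub>R\<^esub>) i"
      by simp
    then have "I +>\<^bsub>R\<^esub> a i = I"
      using i I.a_coset_add_zero[OF I.a_subset] by (simp add: coords_def)
    moreover have "a i \<in> carrier R"
      using a i by auto
    ultimately show ?thesis
      using I.a_rcos_self by blast
  qed
  then show ?thesis
    using that y by blast
qed

theorem theorem1p1:
  fixes K :: "('k, 'c) ring_scheme" and R :: "('k, 'a, 'b) module_scheme"
    and I J1 J2 :: "'a set" and s t :: nat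
  assumes "assoc_algebra K R"
    and "ideal I R" and "ideal J1 R" and "ideal J2 R" and "J1 \<subset> J2"
    and "\<And>a x. \<lbrakk>a \<in> I; x \<in> J2\<rbrakk> \<Longrightarrow> a \<otimes>\<^bsub>R\<^esub> x \<in> J1"
    and "\<And>a x. \<lbrakk>a \<in> I; x \<in> J2\<rbrakk> \<Longrightarrow> x \<otimes>\<^bsub>R\<^esub> a \<in> J1"
    and "left_free_of_rank (R Quot I) (subquotient R J2 J1) (rcoset_mult R J1) s"
    and "right_free_of_rank (R Quot I) (subquotient R J2 J1) (rcoset_mult R J1) t"
    and "s < t"
  shows "\<not> (\<exists>\<Gamma>. finite_nat_filtration K R \<Gamma> \<and> left_noetherian (assoc_graded R \<Gamma>))"
proof
  assume "\<exists>\<Gamma>. finite_nat_filtration K R \<Gamma> \<and> left_noetherian (assoc_graded R \<Gamma>)"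
  then obtain \<Gamma> where \<Gamma>: "nat_filtration K R \<Gamma>" "\<And>i. fin_dim_subspace K R (\<Gamma> i)"
      "left_noetherian (assoc_graded R \<Gamma>)"
    unfolding finite_nat_filtration_def by blast
  interpret noetherian_filtration K R \<Gamma>
    using \<Gamma> by (intro noetherian_filtration.intro filtered_algebra.intro noetherian_filtration_axioms.intro)
  obtain x where x: "\<And>i. i < s \<Longrightarrow> x i \<in> J2"
    "\<And>z. z \<in> J2 \<Longrightarrow> \<exists>a \<in> {..<s} \<rightarrow> carrier R. \<exists>u \<in> J1. z = u \<oplus>\<^bsub>R\<^esub> (\<Oplus>\<^bsub>R\<^esub>i\<in>{..<s}. a i \<otimes>\<^bsub>R\<^esub> x i)"
    using left_free_generators[OF assms(2-4,6,8)] by blast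
  obtain y where y: "\<And>i. i < t \<Longrightarrow> y i \<in> J2"
    "\<And>a i. \<lbrakk>a \<in> {..<t} \<rightarrow> carrier R; (\<Oplus>\<^bsub>R\<^esub>i\<in>{..<t}. y i \<otimes>\<^bsub>R\<^esub> a i) \<in> J1; i < t\<rbrakk> \<Longrightarrow> a i \<in> I"
    using right_free_independent[OF assms(2-4,7,9)] by blast
  have "t \<le> s"
  proof (rule free_rank_le[OF assms(2-5)])
    show "a \<otimes>\<^bsub>R\<^esub> z \<in> J1" if "a \<in> I" "z \<in> J2" for a z
      using that by (rule assms(6))
    show "a i \<in> I" if "a \<in> {..<t} \<rightarrow> carrier R" "(\<Oplus>\<^bsub>R\<^esub>i\<in>{..<t}. y i \<otimes>\<^bsub>R\<^esub> a i) \<in> J1" "i < t" for a i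
      using that by (rule y(2))
  qed (fact x y(1))+
  then show False
    using assms(10) by simp
qed

end
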